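(* (i) For all positive integers $n,d$ and every moment functional $L:\mathbb{R}[x_1,\dots,x_n]_{\leq 2d}\to\mathbb{R}$ there is a $D$ with $d\le D\leq 2d$ and an extension of $L$ to a moment functional $L_0:\mathbb{R}[x_1,\dots,x_n]_{\leq 2D}\to\mathbb{R}$ that admits a flat extension $L_\infty:\mathbb{R}[x_1,\dots,x_n]\to\mathbb{R}$. (ii) For every $d\in\mathbb{N}$ there is an $N\in\mathbb{N}$ such that for every $n\geq N$ there is a moment functional $L$ on $\mathbb{R}[x_1,\dots,x_n]_{\leq 2d}$ for which $D=2d$ in (i) is required; that is, for no $D$ with $d\leq D<2d$ does there exist an extension of $L$ to a moment functional $L_0:\mathbb{R}[x_1,\dots,x_n]_{\leq 2D}\to\mathbb{R}$ that admits a flat extension $L_\infty:\mathbb{R}[x_1,\dots,x_n]\to\mathbb{R}$.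
   Context: A linear functional $L:\mathbb{R}[x_1,\dots,x_n]_{\leq 2D}\to\mathbb{R}$ is a moment functional if there is a positive Borel measure $\mu$ on $\mathbb{R}^n$, with all polynomials of degree at most $2D$ integrable, such that $L(f)=\int_{\mathbb{R}^n} f\,d\mu$ for all $f\in\mathbb{R}[x_1,\dots,x_n]_{\leq 2D}$. For a linear functional $L:\mathbb{R}[x_1,\dots,x_n]_{\leq 2D}\to\mathbb{R}$ the Hankel matrix is $\mathcal{H}(L)=(L(x^{\alpha+\beta}))_{|\alpha|,|\beta|\leq D}$, $\alpha,\beta\in\mathbb{N}_0^n$. An extension $L_1:\mathbb{R}[x_1,\dots,x_n]_{\leq 2D+2}\to\mathbb{R}$ of $L_0:\mathbb{R}[x_1,\dots,x_n]_{\leq 2D}\to\mathbb{R}$ is flat with respect to $L_0$ if $\operatorname{rank}\mathcal{H}(L_1)=\operatorname{rank}\mathcal{H}(L_0)$. A linear functional $L_\infty:\mathbb{R}[x_1,\dots,x_n]\to\mathbb{R}$ is a flat extension of $L_0:\mathbb{R}[x_1,\dots,x_n]_{\leq 2D}\to\mathbb{R}$ if it extends $L_0$ and for every $D'\geq D$ the restriction $L_\infty|_{\mathbb{R}[x_1,\dots,x_n]_{\leq 2D'+2}}$ is flat with respect to $L_\infty|_{\mathbb{R}[x_1,\dots,x_n]_{\leq 2D'}}$.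
   Formalization: Part (ii) is stated for every d except d = 1, where the claim is false: a moment functional of degree at most 2 is always represented by affinely independent atoms (an affine image of a regular simplex), so D = 1 already admits a flat extension. *)

theory Defs
  imports
    "HOL-Library.Poly_Mapping"
    "HOL-Analysis.Bochner_Integration"
    "Jordan_Normal_Form.DL_Rank"
begin

text \<open>
  Polynomials in variables indexed by natural numbers are finitely supported maps from exponent
  vectors to coefficients; the ring operations are those of \<^theory>\<open>HOL-Library.Poly_Mapping\<close>.
  The number of variables \<open>n\<close> is a parameter: \<open>\<real>[x\<^sub>1,\<dots>,x\<^sub>n]\<close> consists of the polynomials
  in which only the variables \<open>0,\<dots>,n-1\<close> occur.
\<close>

type_synonym expo = "nat \<Rightarrow>\<^sub>0 nat"
type_synonym rpoly = "expo \<Rightarrow>\<^sub>0 real"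

definition expo_deg :: "expo \<Rightarrow> nat" where
  "expo_deg \<alpha> = (\<Sum>i\<in>Poly_Mapping.keys \<alpha>. Poly_Mapping.lookup \<alpha> i)"

definition expos_le :: "nat \<Rightarrow> nat \<Rightarrow> expo set" where
  "expos_le n k = {\<alpha>. Poly_Mapping.keys \<alpha> \<subseteq> {..<n} \<and> expo_deg \<alpha> \<le> k}"

definition polys :: "nat \<Rightarrow> rpoly set" where
  "polys n = {p. \<forall>\<alpha>\<in>Poly_Mapping.keys p. Poly_Mapping.keys \<alpha> \<subseteq> {..<n}}"

definition polys_le :: "nat \<Rightarrow> nat \<Rightarrow> rpoly set" where
  "polys_le n k = {p. Poly_Mapping.keys p \<subseteq> expos_le n k}"

definition mono_poly :: "expo \<Rightarrow> rpoly" where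
  "mono_poly \<alpha> = Poly_Mapping.single \<alpha> 1"

definition const_poly :: "real \<Rightarrow> rpoly" where
  "const_poly c = Poly_Mapping.single 0 c"

definition eval_poly :: "(nat \<Rightarrow> real) \<Rightarrow> rpoly \<Rightarrow> real" where
  "eval_poly x p = (\<Sum>\<alpha>\<in>Poly_Mapping.keys p. Poly_Mapping.lookup p \<alpha> *
     (\<Prod>i\<in>Poly_Mapping.keys \<alpha>. x i ^ Poly_Mapping.lookup \<alpha> i))"

text \<open>
  A functional on a subspace \<open>V\<close> is a function on all polynomials of which only the values on \<open>V\<close>
  matter; restricting it to a smaller subspace leaves the function unchanged.
\<close>

definition linear_functional_on :: "rpoly set \<Rightarrow> (rpoly \<Rightarrow> real) \<Rightarrow> bool" where
  "linear_functional_on V L \<longleftrightarrow>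
     (\<forall>p\<in>V. \<forall>q\<in>V. L (p + q) = L p + L q) \<and> (\<forall>c. \<forall>p\<in>V. L (const_poly c * p) = c * L p)"

definition extends_on :: "rpoly set \<Rightarrow> (rpoly \<Rightarrow> real) \<Rightarrow> (rpoly \<Rightarrow> real) \<Rightarrow> bool" where
  "extends_on V L' L \<longleftrightarrow> (\<forall>p\<in>V. L' p = L p)"

text \<open>
  The points of \<open>\<real>\<^sup>n\<close> are the extensional functions on \<open>{..<n}\<close>. Its Borel sets are those of the
  finite product of \<open>borel\<close>, which is the Borel sigma-algebra because \<open>\<real>\<close> is second countable.
\<close>

definition moment_functional :: "nat \<Rightarrow> nat \<Rightarrow> (rpoly \<Rightarrow> real) \<Rightarrow> bool" where
  "moment_functional n k L \<longleftrightarrow>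
     linear_functional_on (polys_le n k) L \<and>
     (\<exists>\<mu> :: (nat \<Rightarrow> real) measure.
        sets \<mu> = sets (Pi\<^sub>M {..<n} (\<lambda>_. borel)) \<and>
        (\<forall>p\<in>polys_le n k. integrable \<mu> (\<lambda>x. eval_poly x p)) \<and>
        (\<forall>p\<in>polys_le n k. L p = (\<integral>x. eval_poly x p \<partial>\<mu>)))"

text \<open>
  The index set \<open>{\<alpha>. |\<alpha>| \<le> D}\<close> of the Hankel matrix is listed in increasing order for the linear
  order on exponent vectors; the rank does not depend on this choice. The list is meaningful only
  because the index set is finite.
\<close>

lemma finite_expos_le: "finite (expos_le n k)"
proof (rule finite_subset)
  let ?F = "{f. \<forall>i. (i \<in> {..<n} \<longrightarrow> f i \<in> {..k}) \<and> (i \<notin> {..<n} \<longrightarrow> f i = (0::nat))}"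
  have "Poly_Mapping.lookup \<alpha> i \<le> k" if "expo_deg \<alpha> \<le> k" for \<alpha> i
  proof (cases "i \<in> Poly_Mapping.keys \<alpha>")
    case True
    then have "Poly_Mapping.lookup \<alpha> i \<le> expo_deg \<alpha>"
      unfolding expo_deg_def by (intro member_le_sum) auto
    with that show ?thesis by simp
  qed (simp add: in_keys_iff)
  then have "Poly_Mapping.lookup ` expos_le n k \<subseteq> ?F"
    by (auto simp: expos_le_def in_keys_iff subset_iff)
  moreover have "finite ?F"
    by (rule finite_set_of_finite_funs) auto
  ultimately have "finite (Poly_Mapping.lookup ` expos_le n k)"
    by (rule finite_subset)
  then show "finite (expos_le n k)"
    by (rule finite_imageD) (auto intro!: inj_onI simp: poly_mapping_eqI)
qed simp

definition hankel :: "nat \<Rightarrow> nat \<Rightarrow> (rpoly \<Rightarrow> real) \<Rightarrow> real mat" where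
  "hankel n D L =
     (let as = sorted_list_of_set (expos_le n D)
      in mat (length as) (length as) (\<lambda>(i, j). L (mono_poly (as ! i + as ! j))))"

definition hankel_rank :: "nat \<Rightarrow> nat \<Rightarrow> (rpoly \<Rightarrow> real) \<Rightarrow> nat" where
  "hankel_rank n D L = vec_space.rank (card (expos_le n D)) (hankel n D L)"

text \<open>\<open>flat n D L\<^sub>1 L\<^sub>0\<close>: \<open>L\<^sub>1\<close> is considered in degree \<open>\<le> 2D+2\<close> and \<open>L\<^sub>0\<close> in degree \<open>\<le> 2D\<close>.\<close>

definition flat :: "nat \<Rightarrow> nat \<Rightarrow> (rpoly \<Rightarrow> real) \<Rightarrow> (rpoly \<Rightarrow> real) \<Rightarrow> bool" where
  "flat n D L\<^sub>1 L\<^sub>0 \<longleftrightarrow>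
     linear_functional_on (polys_le n (2 * D)) L\<^sub>0 \<and>
     linear_functional_on (polys_le n (2 * D + 2)) L\<^sub>1 \<and>
     extends_on (polys_le n (2 * D)) L\<^sub>1 L\<^sub>0 \<and>
     hankel_rank n (D + 1) L\<^sub>1 = hankel_rank n D L\<^sub>0"

definition flat_extension :: "nat \<Rightarrow> nat \<Rightarrow> (rpoly \<Rightarrow> real) \<Rightarrow> (rpoly \<Rightarrow> real) \<Rightarrow> bool" where
  "flat_extension n D Linf L\<^sub>0 \<longleftrightarrow>
     linear_functional_on (polys n) Linf \<and>
     extends_on (polys_le n (2 * D)) Linf L\<^sub>0 \<and>
     (\<forall>D'\<ge>D. flat n D' Linf Linf)"

text \<open>
  The sharpness claim, that \<open>D = 2d\<close> can be necessary for large \<open>n\<close>, is false for \<open>d = 1\<close>, so that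
  value is excluded. A nonzero moment functional of degree \<open>\<le> 2\<close> is determined by its mass, mean
  and covariance; with \<open>s\<close> the rank of the covariance, it is also represented by \<open>s + 1\<close> equally
  weighted affinely independent atoms (an affine image of a regular simplex). Integration against
  these atoms has Hankel matrices of rank \<open>s + 1\<close> for all \<open>D \<ge> 1\<close>, so \<open>D = 1\<close> always suffices.
\<close>

end

theory Submission
  imports Defs
begin

text \<open>
  \<^emph>\<open>The upper bound.\<close> On a finite-dimensional space of integrable functions, integration against any
  measure agrees with a finite nonnegative combination of point evaluations
  (\<open>integral_in_cone_of_values\<close>), and by Caratheodory's argument the evaluations can be taken linearly
  independent with positive weights (\<open>exists_indep_positive_representation\<close>). If
  \<open>L = \<Sum>\<^sub>x w\<^sub>x ev\<^sub>x\<close> on degree \<open>\<le> 2d\<close> is such a representation, the same sum makes sense on all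
  polynomials. Its Hankel matrix in degree \<open>D\<close> is \<open>V diag(w) V\<^sup>T\<close>, where \<open>V\<close> has the columns
  \<open>(x\<^sup>\<alpha>)\<close> with \<open>|\<alpha>| \<le> D\<close>. As soon as \<open>D \<ge> 2d\<close> these columns are independent, so that
  the rank is the number of atoms and stays constant: the extension is flat from \<open>D = 2d\<close> on.

  \<^emph>\<open>Sharpness.\<close> A flat extension from \<open>D < 2d\<close> has Hankel rank at most the number of monomials of
  degree \<open>\<le> 2d-1\<close>, which for fixed \<open>d\<close> grows like \<open>n\<close> to the power \<open>2d-1\<close>. It therefore suffices
  to find a moment functional that forces a rank of order \<open>n\<close> to the power \<open>2d\<close>. Take \<open>L\<close>
  supported on the vertices of the cube \<open>{0,1}\<^sup>n\<close>. For \<open>d \<ge> 2\<close> the values of \<open>L\<close> in degree \<open>\<le> 2d\<close>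
  reveal this support, because they include those at the squares \<open>(x\<^sub>i\<^sup>2 - x\<^sub>i)\<^sup>2\<close> of degree \<open>4\<close>,
  which are \<open>0\<close>. Every representing measure of an extension \<open>L\<^sub>0\<close> lives on the cube, so
  \<open>x\<^sub>i\<^sup>2 - x\<^sub>i\<close> lies in the kernel of the Hankel matrix of \<open>L\<^sub>0\<close>, and flatness propagates this relation to all degrees (\<open>hankel_relation_extends\<close>). Hence \<open>L\<^sub>\<infinity>\<close> factors
  through the functions on the cube and is a signed combination of vertex evaluations, whose number of
  nonzero terms is exactly the Hankel rank (\<open>boolean_flat_extension_sparse\<close>). On the squarefree
  monomials of degree \<open>2d\<close>, of which there are \<open>n choose 2d\<close>, a combination of fewer vertex
  evaluations than that is confined to one of finitely many hyperplanes, and the weights of \<open>L\<close> can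
  be chosen so that all of these are avoided (\<open>exists_positive_vector_avoiding_hyperplanes\<close>).
\<close>

section \<open>Independent columns and rank\<close>

text \<open>
  Columns are indexed rather than collected into a set of vectors, so that equal columns with different
  indices count as dependent and submatrices are obtained by restricting the index sets.
\<close>

definition indep_cols :: "'a set \<Rightarrow> ('a \<Rightarrow> 'b \<Rightarrow> real) \<Rightarrow> 'b set \<Rightarrow> bool" where
  "indep_cols R M J \<longleftrightarrow> (\<forall>c. (\<forall>i\<in>R. (\<Sum>j\<in>J. c j * M i j) = 0) \<longrightarrow> (\<forall>j\<in>J. c j = 0))"

definition spanned_by_cols :: "'a set \<Rightarrow> ('a \<Rightarrow> 'b \<Rightarrow> real) \<Rightarrow> 'b set \<Rightarrow> 'b \<Rightarrow> bool" where
  "spanned_by_cols R M J k \<longleftrightarrow> (\<exists>a. \<forall>i\<in>R. M i k = (\<Sum>j\<in>J. a j * M i j))"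

definition col_basis :: "'a set \<Rightarrow> ('a \<Rightarrow> 'b \<Rightarrow> real) \<Rightarrow> 'b set \<Rightarrow> 'b set \<Rightarrow> bool" where
  "col_basis R M C J \<longleftrightarrow> J \<subseteq> C \<and> indep_cols R M J \<and> (\<forall>k\<in>C. spanned_by_cols R M J k)"

lemma indep_colsD:
  assumes "indep_cols R M J" and "\<And>i. i \<in> R \<Longrightarrow> (\<Sum>j\<in>J. c j * M i j) = 0" and "j \<in> J"
  shows "c j = 0"
  using assms unfolding indep_cols_def by blast

lemma indep_cols_mono_rows: "indep_cols R M J \<Longrightarrow> R \<subseteq> R' \<Longrightarrow> indep_cols R' M J"
  unfolding indep_cols_def by blast

text \<open>
  Gaussian elimination: one equation serves to eliminate one unknown, which leaves one equation and one
  unknown less.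
\<close>

lemma underdetermined_not_indep:
  assumes "finite R" "finite J" "card R < card J"
  shows "\<not> indep_cols R M J"
  using assms
proof (induction R arbitrary: J M rule: finite_induct)
  case empty
  then obtain j where "j \<in> J" by fastforce
  then show ?case unfolding indep_cols_def by (auto intro!: exI[of _ "\<lambda>_. 1"])
next
  case (insert r R)
  show ?case
  proof (cases "\<forall>j\<in>J. M r j = 0")
    case True
    have "\<not> indep_cols R M J" using insert by auto
    with True show ?thesis unfolding indep_cols_def by auto
  next
    case False
    then obtain p where p: "p \<in> J" "M r p \<noteq> 0" by blast
    \<comment> \<open>Equation \<open>r\<close> is solved for the unknown \<open>p\<close>, which is substituted into the others.\<close>
    define M' where "M' i j = M i j - M i p * M r j / M r p" for i j
    have "\<not> indep_cols R M' (J - {p})"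
      using insert p by (intro insert.IH) auto
    then obtain c k where c: "\<And>i. i \<in> R \<Longrightarrow> (\<Sum>j\<in>J - {p}. c j * M' i j) = 0"
      and k: "k \<in> J - {p}" "c k \<noteq> 0"
      unfolding indep_cols_def by blast
    define S where "S = (\<Sum>j\<in>J - {p}. c j * M r j)"
    define c' where "c' = c(p := - S / M r p)"
    have split: "(\<Sum>j\<in>J. c' j * M i j) = (\<Sum>j\<in>J - {p}. c j * M i j) - S / M r p * M i p" for i
      using p insert.prems(1) by (subst sum.remove[of _ p]) (auto simp: c'_def intro!: sum.cong)
    have "(\<Sum>j\<in>J. c' j * M i j) = 0" if "i \<in> insert r R" for i
    proof (cases "i = r")
      case True
      then show ?thesis using p by (simp add: split S_def)
    next
      case False
      then have "0 = (\<Sum>j\<in>J - {p}. c j * M' i j)" using c that by auto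
      also have "\<dots> = (\<Sum>j\<in>J - {p}. c j * M i j) - (\<Sum>j\<in>J - {p}. M i p / M r p * (c j * M r j))"
        unfolding sum_subtractf[symmetric] M'_def by (intro sum.cong) (auto simp: field_simps)
      also have "\<dots> = (\<Sum>j\<in>J. c' j * M i j)"
        by (simp add: split S_def sum_divide_distrib[symmetric] sum_distrib_left[symmetric] mult.commute)
      finally show ?thesis by simp
    qed
    moreover have "c' k \<noteq> 0" "k \<in> J" using k by (auto simp: c'_def)
    ultimately show ?thesis unfolding indep_cols_def by blast
  qed
qed

text \<open>
  The coefficients that express the columns of \<open>K\<close> by those of \<open>J\<close> form a \<open>J \<times> K\<close> system; if it had
  fewer rows than columns, a nontrivial solution would be a relation among the columns of \<open>K\<close>.
\<close>

lemma card_indep_le_card_spanning: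
  assumes "finite J" "finite K" and K: "indep_cols R M K"
    and span: "\<And>k. k \<in> K \<Longrightarrow> spanned_by_cols R M J k"
  shows "card K \<le> card J"
proof (rule ccontr)
  assume less: "\<not> card K \<le> card J"
  obtain a where a: "\<And>k i. k \<in> K \<Longrightarrow> i \<in> R \<Longrightarrow> M i k = (\<Sum>j\<in>J. a k j * M i j)"
    using span unfolding spanned_by_cols_def by metis
  have "\<not> indep_cols J (\<lambda>j k. a k j) K"
    using less assms by (intro underdetermined_not_indep) auto
  then obtain c k where c: "\<And>j. j \<in> J \<Longrightarrow> (\<Sum>k\<in>K. c k * a k j) = 0" and k: "k \<in> K" "c k \<noteq> 0"
    unfolding indep_cols_def by blast
  have "(\<Sum>k\<in>K. c k * M i k) = 0" if "i \<in> R" for i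
  proof -
    have "(\<Sum>k\<in>K. c k * M i k) = (\<Sum>k\<in>K. \<Sum>j\<in>J. c k * a k j * M i j)"
      using a that by (auto simp: sum_distrib_left mult.assoc intro!: sum.cong)
    also have "\<dots> = (\<Sum>j\<in>J. (\<Sum>k\<in>K. c k * a k j) * M i j)"
      by (subst sum.swap) (simp add: sum_distrib_right)
    also have "\<dots> = 0" using c by simp
    finally show ?thesis .
  qed
  from indep_colsD[OF K this k(1)] k(2) show False by blast
qed

lemma spanned_if_not_indep_insert:
  assumes "finite J" "indep_cols R M J" "\<not> indep_cols R M (insert k J)"
  shows "spanned_by_cols R M J k"
proof -
  have kJ: "k \<notin> J" using assms by (auto simp: insert_absorb)
  obtain c where c: "\<And>i. i \<in> R \<Longrightarrow> (\<Sum>j\<in>insert k J. c j * M i j) = 0"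
    and nz: "\<exists>j\<in>insert k J. c j \<noteq> 0"
    using assms(3) unfolding indep_cols_def by blast
  have *: "c k * M i k + (\<Sum>j\<in>J. c j * M i j) = 0" if "i \<in> R" for i
    using c[OF that] kJ assms(1) by simp
  have ck: "c k \<noteq> 0"
  proof
    assume "c k = 0"
    with * have "\<And>i. i \<in> R \<Longrightarrow> (\<Sum>j\<in>J. c j * M i j) = 0" by auto
    from indep_colsD[OF assms(2) this] nz \<open>c k = 0\<close> show False by blast
  qed
  have "M i k = (\<Sum>j\<in>J. (- c j / c k) * M i j)" if "i \<in> R" for i
  proof -
    have "(\<Sum>j\<in>J. (- c j / c k) * M i j) = - (\<Sum>j\<in>J. c j * M i j) / c k"
      by (simp add: sum_negf sum_divide_distrib)
    also have "\<dots> = M i k" using *[OF that] ck by (simp add: field_simps)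
    finally show ?thesis by simp
  qed
  then show ?thesis unfolding spanned_by_cols_def by (intro exI[of _ "\<lambda>j. - c j / c k"]) blast
qed

text \<open>
  This computes the rank of \<open>V diag(w) V\<^sup>T\<close> for independent columns of \<open>V\<close> and nonzero weights of any
  sign. A relation of the rows of \<open>V\<close> over \<open>J\<close> is a relation of the columns of the product, which
  bounds \<open>card J\<close> from above. Conversely, independence of the columns of \<open>V\<close> turns every relation of
  the columns of the product into one of the rows of \<open>V\<close>, so all rows of \<open>V\<close> are combinations of those
  in \<open>J\<close>, and fewer than \<open>card X\<close> rows cannot span.
\<close>

lemma card_col_basis_weighted_gram:
  assumes fin: "finite E" "finite X" and V: "indep_cols E V X" and w: "\<And>x. x \<in> X \<Longrightarrow> w x \<noteq> 0"
    and H: "\<And>\<alpha> \<beta>. \<alpha> \<in> E \<Longrightarrow> \<beta> \<in> E \<Longrightarrow> H \<alpha> \<beta> = (\<Sum>x\<in>X. w x * V \<alpha> x * V \<beta> x)"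
    and J: "col_basis E H E J"
  shows "card J = card X"
proof (rule antisym)
  have JE: "J \<subseteq> E" and ind: "indep_cols E H J" and span: "\<And>k. k \<in> E \<Longrightarrow> spanned_by_cols E H J k"
    using J by (auto simp: col_basis_def)
  have finJ: "finite J" using JE fin finite_subset by blast
  have H_sum: "(\<Sum>\<beta>\<in>J. c \<beta> * H \<alpha> \<beta>) = (\<Sum>x\<in>X. w x * (\<Sum>\<beta>\<in>J. c \<beta> * V \<beta> x) * V \<alpha> x)" if "\<alpha> \<in> E" for c \<alpha>
  proof -
    have "(\<Sum>\<beta>\<in>J. c \<beta> * H \<alpha> \<beta>) = (\<Sum>\<beta>\<in>J. \<Sum>x\<in>X. w x * (c \<beta> * V \<beta> x) * V \<alpha> x)"
      using that JE by (intro sum.cong) (auto simp: H sum_distrib_left mult_ac intro!: sum.cong)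
    also have "\<dots> = (\<Sum>x\<in>X. w x * (\<Sum>\<beta>\<in>J. c \<beta> * V \<beta> x) * V \<alpha> x)"
      by (subst sum.swap) (simp add: sum_distrib_left sum_distrib_right)
    finally show ?thesis .
  qed
  show "card J \<le> card X"
  proof (rule ccontr)
    assume "\<not> card J \<le> card X"
    then have "\<not> indep_cols X (\<lambda>x \<beta>. V \<beta> x) J"
      using fin finJ by (intro underdetermined_not_indep) auto
    then obtain c k where c: "\<And>x. x \<in> X \<Longrightarrow> (\<Sum>\<beta>\<in>J. c \<beta> * V \<beta> x) = 0" and k: "k \<in> J" "c k \<noteq> 0"
      unfolding indep_cols_def by blast
    have "(\<Sum>\<beta>\<in>J. c \<beta> * H \<alpha> \<beta>) = 0" if "\<alpha> \<in> E" for \<alpha>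
      using c by (simp add: H_sum[OF that])
    from indep_colsD[OF ind this k(1)] k(2) show False by blast
  qed
  show "card X \<le> card J"
  proof (rule ccontr)
    assume "\<not> card X \<le> card J"
    then have "\<not> indep_cols J (\<lambda>\<beta> x. w x * V \<beta> x) X"
      using fin finJ by (intro underdetermined_not_indep) auto
    then obtain b y where b: "\<And>\<beta>. \<beta> \<in> J \<Longrightarrow> (\<Sum>x\<in>X. b x * (w x * V \<beta> x)) = 0"
      and y: "y \<in> X" "b y \<noteq> 0"
      unfolding indep_cols_def by blast
    have "(\<Sum>x\<in>X. (b x * w x) * V \<gamma> x) = 0" if g: "\<gamma> \<in> E" for \<gamma>
    proof -
      obtain a where a: "\<And>\<alpha>. \<alpha> \<in> E \<Longrightarrow> H \<alpha> \<gamma> = (\<Sum>\<beta>\<in>J. a \<beta> * H \<alpha> \<beta>)"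
        using span[OF g] unfolding spanned_by_cols_def by blast
      have "(\<Sum>x\<in>X. (w x * (V \<gamma> x - (\<Sum>\<beta>\<in>J. a \<beta> * V \<beta> x))) * V \<alpha> x) = 0" if "\<alpha> \<in> E" for \<alpha>
      proof -
        have "(\<Sum>x\<in>X. (w x * (V \<gamma> x - (\<Sum>\<beta>\<in>J. a \<beta> * V \<beta> x))) * V \<alpha> x)
            = H \<alpha> \<gamma> - (\<Sum>\<beta>\<in>J. a \<beta> * H \<alpha> \<beta>)"
          unfolding H_sum[OF that] H[OF that g] sum_subtractf[symmetric]
          by (intro sum.cong) (auto simp: algebra_simps)
        with a[OF that] show ?thesis by simp
      qed
      from indep_colsD[OF V this] w have "V \<gamma> x = (\<Sum>\<beta>\<in>J. a \<beta> * V \<beta> x)" if "x \<in> X" for x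
        using that by force
      then have "(\<Sum>x\<in>X. (b x * w x) * V \<gamma> x) = (\<Sum>x\<in>X. \<Sum>\<beta>\<in>J. a \<beta> * (b x * (w x * V \<beta> x)))"
        by (auto simp: sum_distrib_left mult_ac intro!: sum.cong)
      also have "\<dots> = (\<Sum>\<beta>\<in>J. a \<beta> * (\<Sum>x\<in>X. b x * (w x * V \<beta> x)))"
        by (subst sum.swap) (simp add: sum_distrib_left)
      also have "\<dots> = 0" using b by simp
      finally show ?thesis .
    qed
    from indep_colsD[OF V this y(1)] y(2) w[OF y(1)] show False by simp
  qed
qed

text \<open>
  The rank from the vector space library is the size of a maximal independent set of column vectors;
  picking one index for each of these vectors translates it to the index-based notions above.
\<close>

lemma rank_eq_card_col_basis:
  fixes as :: "'a list" and M :: "'a \<Rightarrow> 'a \<Rightarrow> real"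
  assumes "distinct as"
  defines "A \<equiv> mat (length as) (length as) (\<lambda>(i, j). M (as ! i) (as ! j))"
  shows "\<exists>J. col_basis (set as) M (set as) J \<and> vec_space.rank (length as) A = card J"
proof -
  let ?n = "length as"
  define v where "v k = Matrix.vec ?n (\<lambda>i. M (as ! i) k)" for k
  interpret vec_space "TYPE(real)" ?n .
  have A: "A \<in> carrier_mat ?n ?n" by (simp add: A_def)
  have cols: "set (cols A) = v ` set as"
  proof -
    have "col A j = v (as ! j)" if "j < ?n" for j
      using that by (auto simp: A_def v_def)
    then have "set (cols A) = (\<lambda>j. v (as ! j)) ` {..<?n}"
      using A by (auto simp: cols_def)
    also have "\<dots> = v ` set as" by (auto simp: set_conv_nth)
    finally show ?thesis .
  qed
  obtain S where S: "maximal S (\<lambda>T. T \<subseteq> set (cols A) \<and> lin_indpt T)"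
    using maximal_exists_superset[of "set (cols A)" "\<lambda>T. T \<subseteq> set (cols A) \<and> lin_indpt T" "{}"]
    by (auto simp: finite_lin_indpt2)
  have rank: "rank A = card S" by (rule rank_card_indpt[OF A S])
  have Sc: "S \<subseteq> v ` set as" and Sind: "lin_indpt S" 
    and Smax: "\<And>T. S \<subseteq> T \<Longrightarrow> T \<subseteq> v ` set as \<Longrightarrow> lin_indpt T \<Longrightarrow> S = T"
    using S unfolding maximal_def cols by auto
  obtain J where J: "J \<subseteq> set as" "inj_on v J" "S = v ` J"
    using subset_image_inj[of S v "set as"] Sc by auto
  have finJ: "finite J" using J(1) finite_subset by blast
  have carr: "v ` K \<subseteq> carrier_vec ?n" for K by (auto simp: v_def)
  have indep_iff: "lin_indpt (v ` K) \<longleftrightarrow> indep_cols (set as) M K"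
    if K: "K \<subseteq> set as" "inj_on v K" for K
  proof -
    have finK: "finite K" using K(1) finite_subset by blast
    have comb: "lincomb c (v ` K) = 0\<^sub>v ?n \<longleftrightarrow> (\<forall>i\<in>set as. (\<Sum>k\<in>K. c (v k) * M i k) = 0)" for c
    proof -
      have ix: "vec_index (lincomb c (v ` K)) i = (\<Sum>k\<in>K. c (v k) * M (as ! i) k)" if "i < ?n" for i
        using that unfolding lincomb_index[OF that carr] sum.reindex[OF K(2)]
        by (intro sum.cong) (auto simp: v_def)
      have "lincomb c (v ` K) \<in> carrier_vec ?n"
        using carr[of K] finK by (intro lincomb_closed) auto
      then have "lincomb c (v ` K) = 0\<^sub>v ?n \<longleftrightarrow> (\<forall>i<?n. (\<Sum>k\<in>K. c (v k) * M (as ! i) k) = 0)"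
        using ix by (auto simp: Matrix.vec_eq_iff)
      then show ?thesis by (simp add: all_set_conv_all_nth)
    qed
    show ?thesis
    proof
      assume li: "lin_indpt (v ` K)"
      show "indep_cols (set as) M K"
        unfolding indep_cols_def
      proof (intro allI impI ballI)
        fix c j assume c: "\<forall>i\<in>set as. (\<Sum>j\<in>K. c j * M i j) = 0" and j: "j \<in> K"
        define c' where "c' = (\<lambda>u. c (the_inv_into K v u))"
        have c': "c' (v k) = c k" if "k \<in> K" for k
          using that K(2) by (simp add: c'_def the_inv_into_f_f)
        then have "lincomb c' (v ` K) = 0\<^sub>v ?n" using c by (simp add: comb)
        then have "\<not> c' (v j) \<noteq> 0"
          using li j finK lin_dep_crit[where A = "v ` K" and S = "v ` K" and a = c' and v = "v j"] by (auto simp: class_field_def)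
        with c' j show "c j = 0" by simp
      qed
    next
      assume ic: "indep_cols (set as) M K"
      show "lin_indpt (v ` K)"
      proof (rule finite_lin_indpt2)
        show "finite (v ` K)" using finK by simp
        show "v ` K \<subseteq> carrier_vec ?n" by (rule carr)
        fix a assume "lincomb a (v ` K) = 0\<^sub>v ?n"
        then have "\<And>i. i \<in> set as \<Longrightarrow> (\<Sum>k\<in>K. a (v k) * M i k) = 0" by (simp add: comb)
        from indep_colsD[OF ic this] show "\<forall>v\<in>v ` K. a v = 0" by auto
      qed
    qed
  qed
  have ind: "indep_cols (set as) M J" using Sind J indep_iff by blast
  have "spanned_by_cols (set as) M J k" if k: "k \<in> set as" for k
  proof (cases "v k \<in> S")
    case True
    then obtain j where j: "j \<in> J" "v k = v j" using J(3) by auto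
    have "M i k = M i j" if i: "i \<in> set as" for i
    proof -
      obtain m where "m < ?n" "as ! m = i" using i by (auto simp: in_set_conv_nth)
      then show ?thesis using arg_cong[OF j(2), of "\<lambda>u. vec_index u m"] by (simp add: v_def)
    qed
    then show ?thesis using j(1) finJ unfolding spanned_by_cols_def
      by (intro exI[of _ "\<lambda>l. if l = j then 1 else 0"]) (simp add: if_distrib[of "\<lambda>x. x * _"] cong: if_cong)
  next
    case False
    then have inj: "inj_on v (insert k J)" and sub: "insert k J \<subseteq> set as" using J k by (auto simp: inj_on_insert)
    have "\<not> lin_indpt (v ` insert k J)"
      using Smax[of "v ` insert k J"] False J sub by auto
    then have "\<not> indep_cols (set as) M (insert k J)" using indep_iff[OF sub inj] by simp
    with finJ ind show ?thesis by (intro spanned_if_not_indep_insert)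
  qed
  then have "col_basis (set as) M (set as) J" using J(1) ind by (auto simp: col_basis_def)
  moreover have "card S = card J" using J by (simp add: card_image)
  ultimately show ?thesis using rank by auto
qed

section \<open>Finitely atomic representation of integrals\<close>

text \<open>
  A convex cone that misses a point has a supporting hyperplane through the origin. Induction on the coordinates: if the cone lies on one side of \<open>k e = 0\<close>, that coordinate
  itself is the functional. Otherwise the slice \<open>k e = 0\<close> is again proper, and the functional found on
  the slice is extended by a coefficient \<open>t\<close> for the coordinate \<open>e\<close>, squeezed between the bounds
  imposed by the elements on the two sides, as in the extension theorem of M. Riesz. Only the coordinates
  in \<open>I\<close> matter, hence a point is missed when every element differs from it somewhere on \<open>I\<close>.
\<close>

lemma supporting_functional_of_proper_cone:
  fixes K :: "('i \<Rightarrow> real) set" and y :: "'i \<Rightarrow> real"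
  assumes "finite I"
    and "\<And>k l. k \<in> K \<Longrightarrow> l \<in> K \<Longrightarrow> (\<lambda>i. k i + l i) \<in> K"
    and "\<And>k t. k \<in> K \<Longrightarrow> t \<ge> 0 \<Longrightarrow> (\<lambda>i. t * k i) \<in> K"
    and "\<And>k. k \<in> K \<Longrightarrow> \<exists>i\<in>I. k i \<noteq> y i" and "K \<noteq> {}"
  shows "\<exists>a. (\<exists>i\<in>I. a i \<noteq> 0) \<and> (\<forall>k\<in>K. (\<Sum>i\<in>I. a i * k i) \<ge> 0)"
  using assms
proof (induction I arbitrary: K y rule: finite_induct)
  case empty
  then show ?case by auto
next
  case (insert e I)
  note add = insert.prems(1) and scale = insert.prems(2) and proper = insert.prems(3)
  show ?case
  proof (cases "(\<exists>k\<in>K. k e > 0) \<and> (\<exists>k\<in>K. k e < 0)")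
    case False
    then consider "\<And>k. k \<in> K \<Longrightarrow> k e \<le> 0" | "\<And>k. k \<in> K \<Longrightarrow> k e \<ge> 0" by force
    then show ?thesis
    proof cases
      case 1
      then show ?thesis using insert.hyps
        by (intro exI[of _ "\<lambda>i. if i = e then - 1 else 0"])
           (auto simp: if_distrib[of "\<lambda>x. x * _"] cong: if_cong)
    next
      case 2
      then show ?thesis using insert.hyps
        by (intro exI[of _ "\<lambda>i. if i = e then 1 else 0"])
           (auto simp: if_distrib[of "\<lambda>x. x * _"] cong: if_cong)
    qed
  next
    case True
    then obtain p q where p: "p \<in> K" "p e > 0" and q: "q \<in> K" "q e < 0" by blast
    define K0 where "K0 = {k \<in> K. k e = 0}"
    have zero: "(\<lambda>_. 0) \<in> K" using scale[OF p(1), of 0] by simp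
    have "\<exists>r\<in>K. r e = y e"
    proof (cases "y e \<ge> 0")
      case True
      then show ?thesis using scale[OF p(1), of "y e / p e"] p by (intro bexI) auto
    next
      case False
      then show ?thesis using scale[OF q(1), of "y e / q e"] q
        by (intro bexI) (auto simp: divide_nonpos_nonpos)
    qed
    then obtain r where r: "r \<in> K" "r e = y e" by blast
    have "\<exists>i\<in>I. k i \<noteq> y i - r i" if "k \<in> K0" for k
    proof (rule ccontr)
      assume c: "\<not> ?thesis"
      have "(\<lambda>i. k i + r i) \<in> K" using that add r by (auto simp: K0_def)
      from proper[OF this] c that r show False by (auto simp: K0_def)
    qed
    then have "\<exists>a. (\<exists>i\<in>I. a i \<noteq> 0) \<and> (\<forall>k\<in>K0. (\<Sum>i\<in>I. a i * k i) \<ge> 0)"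
      using add scale zero by (intro insert.IH[where y = "\<lambda>i. y i - r i"]) (auto simp: K0_def)
    then obtain a j where j: "j \<in> I" "a j \<noteq> 0"
      and a: "\<And>k. k \<in> K0 \<Longrightarrow> (\<Sum>i\<in>I. a i * k i) \<ge> 0" by blast
    define \<phi> where "\<phi> k = (\<Sum>i\<in>I. a i * k i)" for k
    \<comment> \<open>The condition \<open>t * k e + \<phi> k \<ge> 0\<close> on the new coefficient \<open>t\<close> is a lower bound on \<open>t\<close> for \<open>k e > 0\<close>
      and an upper bound for \<open>k e < 0\<close>; combining two elements so that \<open>e\<close> cancels shows that the bounds
      are compatible.\<close>
    define A where "A = (\<lambda>k. \<phi> k / - k e) ` {k \<in> K. k e > 0}"
    define B where "B = (\<lambda>k. \<phi> k / - k e) ` {k \<in> K. k e < 0}"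
    have AB: "u \<le> v" if uv: "u \<in> A" "v \<in> B" for u v
    proof -
      obtain k l where k: "k \<in> K" "k e > 0" "u = \<phi> k / - k e"
        and l: "l \<in> K" "l e < 0" "v = \<phi> l / - l e" using uv unfolding A_def B_def by blast
      have "(\<lambda>i. (- l e) * k i + k e * l i) \<in> K"
        using k l by (intro add scale) auto
      then have "(\<lambda>i. (- l e) * k i + k e * l i) \<in> K0" by (auto simp: K0_def)
      from a[OF this] have "0 \<le> (- l e) * \<phi> k + k e * \<phi> l"
        by (simp add: \<phi>_def sum_distrib_left algebra_simps flip: sum.distrib sum_negf)
      then have "- \<phi> k * (- l e) \<le> \<phi> l * k e" by (simp add: mult.commute)
      then have "- \<phi> k / k e \<le> \<phi> l / - l e"
        using k(2) l(2) by (subst frac_le_eq) (auto intro!: divide_nonpos_neg simp: mult_neg_pos mult_pos_neg)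
      then show ?thesis using k(3) l(3) by simp
    qed
    have "A \<noteq> {}" "B \<noteq> {}" using p q by (auto simp: A_def B_def)
    then have "bdd_above A" using AB by (meson bdd_above.I ex_in_conv)
    define t where "t = Sup A"
    have tA: "u \<le> t" if "u \<in> A" for u
      unfolding t_def using that \<open>bdd_above A\<close> by (rule cSup_upper)
    have tB: "t \<le> v" if "v \<in> B" for v
      unfolding t_def using \<open>A \<noteq> {}\<close> AB that by (intro cSup_least) auto
    define a' where "a' = a(e := t)"
    have a': "(\<Sum>i\<in>insert e I. a' i * k i) = t * k e + \<phi> k" for k
      using insert.hyps by (auto simp: a'_def \<phi>_def intro!: sum.cong)
    have "t * k e + \<phi> k \<ge> 0" if "k \<in> K" for k
    proof (cases "k e" "0 :: real" rule: linorder_cases)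
      case less
      then have "t \<le> \<phi> k / - k e" using that by (intro tB) (auto simp: B_def)
      then show ?thesis using less by (simp add: field_simps)
    next
      case equal
      then show ?thesis using a[of k] that by (auto simp: K0_def \<phi>_def)
    next
      case greater
      then have "\<phi> k / - k e \<le> t" using that by (intro tA) (auto simp: A_def)
      then show ?thesis using greater by (simp add: field_simps)
    qed
    moreover have "a' j \<noteq> 0" using j insert.hyps by (auto simp: a'_def)
    ultimately show ?thesis using j a' by (intro exI[of _ a']) auto
  qed
qed

text \<open>
  Support the larger cone \<open>C - \<real>\<^sub>\<ge>\<^sub>0 y\<close>, which still misses \<open>y\<close>: from \<open>k - t y = y\<close> it would follow that
  \<open>y = k / (1 + t)\<close> lies in \<open>C\<close>.
\<close>

lemma separating_functional_of_cone:
  fixes C :: "('i \<Rightarrow> real) set" and y :: "'i \<Rightarrow> real"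
  assumes "finite I"
    and add: "\<And>k l. k \<in> C \<Longrightarrow> l \<in> C \<Longrightarrow> (\<lambda>i. k i + l i) \<in> C"
    and scale: "\<And>k t. k \<in> C \<Longrightarrow> t \<ge> 0 \<Longrightarrow> (\<lambda>i. t * k i) \<in> C"
    and notin: "\<And>k. k \<in> C \<Longrightarrow> \<exists>i\<in>I. k i \<noteq> y i" and "C \<noteq> {}"
  shows "\<exists>a. (\<exists>i\<in>I. a i \<noteq> 0) \<and> (\<forall>k\<in>C. (\<Sum>i\<in>I. a i * k i) \<ge> 0) \<and> (\<Sum>i\<in>I. a i * y i) \<le> 0"
proof -
  define K where "K = {(\<lambda>i. k i - t * y i) | k t. k \<in> C \<and> t \<ge> 0}"
  have KI: "(\<lambda>i. k i - t * y i) \<in> K" if "k \<in> C" "t \<ge> 0" for k t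
    using that by (auto simp: K_def)
  have zero: "(\<lambda>_. 0) \<in> C" using \<open>C \<noteq> {}\<close> scale[where t = 0] by auto
  have "\<exists>a. (\<exists>i\<in>I. a i \<noteq> 0) \<and> (\<forall>k\<in>K. (\<Sum>i\<in>I. a i * k i) \<ge> 0)"
  proof (rule supporting_functional_of_proper_cone[where y = y])
    show "finite I" by fact
    show "K \<noteq> {}" using KI zero by blast
  next
    fix k l assume "k \<in> K" "l \<in> K"
    then obtain k' s l' t where "k' \<in> C" "s \<ge> 0" "l' \<in> C" "t \<ge> 0"
      and eq: "k = (\<lambda>i. k' i - s * y i)" "l = (\<lambda>i. l' i - t * y i)" by (auto simp: K_def)
    then have "(\<lambda>i. (k' i + l' i) - (s + t) * y i) \<in> K" by (intro KI add) auto
    then show "(\<lambda>i. k i + l i) \<in> K" by (simp add: eq algebra_simps)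
  next
    fix k and t :: real assume "k \<in> K" "t \<ge> 0"
    then obtain k' s where "k' \<in> C" "s \<ge> 0" and eq: "k = (\<lambda>i. k' i - s * y i)" by (auto simp: K_def)
    then have "(\<lambda>i. (t * k' i) - (t * s) * y i) \<in> K" using \<open>t \<ge> 0\<close> by (intro KI scale) auto
    then show "(\<lambda>i. t * k i) \<in> K" by (simp add: eq algebra_simps)
  next
    fix k assume "k \<in> K"
    then obtain k' t where k: "k' \<in> C" "t \<ge> 0" and eq: "k = (\<lambda>i. k' i - t * y i)" by (auto simp: K_def)
    obtain i where "i \<in> I" "(1 / (1 + t)) * k' i \<noteq> y i"
      using notin[OF scale[OF k(1), of "1 / (1 + t)"]] k(2) by auto
    then show "\<exists>i\<in>I. k i \<noteq> y i"
    proof (intro bexI[of _ i] notI)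
      assume "k i = y i"
      then have "k' i = (1 + t) * y i" by (simp add: eq algebra_simps)
      with \<open>(1 / (1 + t)) * k' i \<noteq> y i\<close> k(2) show False by simp
    qed
  qed
  then obtain a where nz: "\<exists>i\<in>I. a i \<noteq> 0" and a: "\<And>k. k \<in> K \<Longrightarrow> (\<Sum>i\<in>I. a i * k i) \<ge> 0" by blast
  have "(\<Sum>i\<in>I. a i * k i) \<ge> 0" if "k \<in> C" for k
    using a[OF KI[OF that, of 0]] by simp
  moreover have "(\<Sum>i\<in>I. a i * y i) \<le> 0"
    using a[OF KI[OF zero, of 1]] by (simp add: sum_negf)
  ultimately show ?thesis using nz by blast
qed

text \<open>
  The theorem of Richter and Tchakaloff, for functions on an arbitrary measure space. If the vector of
  integrals is not in the cone spanned by the vectors of values on \<open>S\<close>, a separating functional yields a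
  combination \<open>g\<close> of the functions with \<open>g \<ge> 0\<close> on \<open>S\<close> and integral at most \<open>0\<close>. Then \<open>g = 0\<close> almost
  everywhere, so \<open>S\<close> may be replaced by the zeros of \<open>g\<close>, where one of the functions is a combination of
  the others. The set \<open>S\<close> of full measure is carried along to make this induction possible.
\<close>

lemma integral_in_cone_of_values:
  fixes f :: "'i \<Rightarrow> 'a \<Rightarrow> real"
  assumes "finite I" and "\<And>i. i \<in> I \<Longrightarrow> integrable M (f i)"
    and "S \<in> sets M" and "AE x in M. x \<in> S"
  shows "\<exists>X w. finite X \<and> X \<subseteq> S \<and> (\<forall>x\<in>X. w x \<ge> 0) \<and> (\<forall>i\<in>I. (\<integral>x. f i x \<partial>M) = (\<Sum>x\<in>X. w x * f i x))"
  using assms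
proof (induction "card I" arbitrary: I S rule: less_induct)
  case less
  note int = less.prems(2)
  define y where "y i = (\<integral>x. f i x \<partial>M)" for i
  define C where "C = {(\<lambda>i. \<Sum>x\<in>X. w x * f i x) | X w. finite X \<and> X \<subseteq> S \<and> (\<forall>x\<in>X. w x \<ge> 0)}"
  have CI: "(\<lambda>i. \<Sum>x\<in>X. w x * f i x) \<in> C" if "finite X" "X \<subseteq> S" "\<forall>x\<in>X. w x \<ge> 0" for X w
    using that by (auto simp: C_def)
  show ?case
  proof (rule ccontr)
    assume not: "\<not> ?case"
    have "\<exists>a. (\<exists>i\<in>I. a i \<noteq> 0) \<and> (\<forall>k\<in>C. (\<Sum>i\<in>I. a i * k i) \<ge> 0) \<and> (\<Sum>i\<in>I. a i * y i) \<le> 0"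
    proof (rule separating_functional_of_cone)
      show "finite I" by fact
      show "C \<noteq> {}" using CI[of "{}"] by auto
    next
      fix k assume "k \<in> C"
      then obtain X w where "finite X" "X \<subseteq> S" "\<forall>x\<in>X. w x \<ge> 0" "k = (\<lambda>i. \<Sum>x\<in>X. w x * f i x)"
        by (auto simp: C_def)
      then show "\<exists>i\<in>I. k i \<noteq> y i" using not unfolding y_def by metis
    next
      fix k and t :: real assume "k \<in> C" "t \<ge> 0"
      then obtain X w where X: "finite X" "X \<subseteq> S" "\<forall>x\<in>X. w x \<ge> 0" and eq: "k = (\<lambda>i. \<Sum>x\<in>X. w x * f i x)"
        by (auto simp: C_def)
      then have "(\<lambda>i. \<Sum>x\<in>X. (t * w x) * f i x) \<in> C" using \<open>t \<ge> 0\<close> by (intro CI) auto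
      then show "(\<lambda>i. t * k i) \<in> C" by (simp add: eq sum_distrib_left mult.assoc)
    next
      fix k l assume "k \<in> C" "l \<in> C"
      then obtain X w Y v where X: "finite X" "X \<subseteq> S" "\<forall>x\<in>X. w x \<ge> 0" 
        and Y: "finite Y" "Y \<subseteq> S" "\<forall>x\<in>Y. v x \<ge> 0" 
        and eq: "k = (\<lambda>i. \<Sum>x\<in>X. w x * f i x)" "l = (\<lambda>i. \<Sum>x\<in>Y. v x * f i x)"
        by (auto simp: C_def)
      define u where "u x = (if x \<in> X then w x else 0) + (if x \<in> Y then v x else 0)" for x
      have "(\<lambda>i. \<Sum>x\<in>X \<union> Y. u x * f i x) \<in> C" using X Y by (intro CI) (auto simp: u_def)
      moreover have "(\<Sum>x\<in>X \<union> Y. u x * f i x) = k i + l i" for i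
      proof -
        have "(\<Sum>x\<in>X \<union> Y. u x * f i x) = (\<Sum>x\<in>X \<union> Y. if x \<in> X then w x * f i x else 0)
            + (\<Sum>x\<in>X \<union> Y. if x \<in> Y then v x * f i x else 0)"
          unfolding sum.distrib[symmetric] by (intro sum.cong) (auto simp: u_def algebra_simps)
        also have "(\<Sum>x\<in>X \<union> Y. if x \<in> X then w x * f i x else 0) = k i"
          unfolding eq by (rule sum.mono_neutral_cong_right) (use X(1) Y(1) in auto)
        also have "(\<Sum>x\<in>X \<union> Y. if x \<in> Y then v x * f i x else 0) = l i"
          unfolding eq by (rule sum.mono_neutral_cong_right) (use X(1) Y(1) in auto)
        finally show ?thesis .
      qed
      ultimately show "(\<lambda>i. k i + l i) \<in> C" by simp
    qed
    then obtain a p where p: "p \<in> I" "a p \<noteq> 0" and a: "\<And>k. k \<in> C \<Longrightarrow> (\<Sum>i\<in>I. a i * k i) \<ge> 0"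
      and ay: "(\<Sum>i\<in>I. a i * y i) \<le> 0" by blast
    define g where "g x = (\<Sum>i\<in>I. a i * f i x)" for x
    have g_nn: "g x \<ge> 0" if "x \<in> S" for x
      using a[OF CI[of "{x}" "\<lambda>_. 1"]] that by (simp add: g_def)
    have g_int: "integrable M g" unfolding g_def using int by auto
    have "(\<integral>x. g x \<partial>M) = (\<Sum>i\<in>I. a i * y i)"
      unfolding g_def y_def using int by simp
    moreover have AE_nn: "AE x in M. 0 \<le> g x" using less.prems(4) by eventually_elim (rule g_nn)
    ultimately have "(\<integral>x. g x \<partial>M) = 0" using ay integral_nonneg_AE[OF AE_nn] by simp
    then have "AE x in M. g x = 0"
      using integral_nonneg_eq_0_iff_AE[OF g_int AE_nn] by simp
    define S' where "S' = {x \<in> S. g x = 0}"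
    have [measurable]: "g \<in> borel_measurable M" "S \<in> sets M" using g_int less.prems by auto
    have "S' = S \<inter> {x \<in> space M. g x = 0}" using sets.sets_into_space[OF less.prems(3)] by (auto simp: S'_def)
    then have "S' \<in> sets M" by simp
    moreover have "AE x in M. x \<in> S'" using \<open>AE x in M. g x = 0\<close> less.prems(4)
      by eventually_elim (auto simp: S'_def)
    moreover have "card (I - {p}) < card I" using p(1) less.prems(1) by (rule card_Diff1_less[rotated])
    ultimately have "\<exists>X w. finite X \<and> X \<subseteq> S' \<and> (\<forall>x\<in>X. w x \<ge> 0)
        \<and> (\<forall>i\<in>I - {p}. (\<integral>x. f i x \<partial>M) = (\<Sum>x\<in>X. w x * f i x))"
      using less.prems(1) int by (intro less.hyps) auto
    then obtain X w where X: "finite X" "X \<subseteq> S'" "\<forall>x\<in>X. w x \<ge> 0"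
      and eq: "\<And>i. i \<in> I - {p} \<Longrightarrow> y i = (\<Sum>x\<in>X. w x * f i x)"
      unfolding y_def by blast
    have fp: "a p * f p x = - (\<Sum>i\<in>I - {p}. a i * f i x)" if "g x = 0" for x
      using that p(1) less.prems(1) by (simp add: g_def sum.remove[of I p])
    have "a p * y p = - (\<Sum>i\<in>I - {p}. a i * y i)"
      using \<open>(\<integral>x. g x \<partial>M) = (\<Sum>i\<in>I. a i * y i)\<close> \<open>(\<integral>x. g x \<partial>M) = 0\<close> p(1) less.prems(1)
      by (simp add: sum.remove[of I p])
    also have "\<dots> = (\<Sum>x\<in>X. w x * - (\<Sum>i\<in>I - {p}. a i * f i x))"
      by (simp add: eq sum_distrib_left sum_negf mult_ac sum.swap[of _ X])
    also have "\<dots> = (\<Sum>x\<in>X. w x * (a p * f p x))"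
      using X(2) fp by (intro sum.cong) (auto simp: S'_def)
    also have "\<dots> = a p * (\<Sum>x\<in>X. w x * f p x)"
      by (simp add: sum_distrib_left mult_ac)
    finally have "y p = (\<Sum>x\<in>X. w x * f p x)" using p(2) by simp
    with eq have "\<forall>i\<in>I. y i = (\<Sum>x\<in>X. w x * f i x)" by auto
    moreover have "X \<subseteq> S" using X(2) by (auto simp: S'_def)
    ultimately show False using X not unfolding y_def by metis
  qed
qed

text \<open>
  Caratheodory's argument: subtracting the largest admissible multiple of a linear relation from the
  weights keeps them nonnegative and removes an atom.
\<close>

lemma exists_indep_positive_representation:
  fixes f :: "'i \<Rightarrow> 'a \<Rightarrow> real"
  assumes "finite X" and "\<And>x. x \<in> X \<Longrightarrow> w x \<ge> 0"
  shows "\<exists>Y v. Y \<subseteq> X \<and> (\<forall>x\<in>Y. v x > 0) \<and> (\<forall>i\<in>I. (\<Sum>x\<in>Y. v x * f i x) = (\<Sum>x\<in>X. w x * f i x))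
    \<and> indep_cols I f Y"
  using assms
proof (induction "card X" arbitrary: X w rule: less_induct)
  case less
  show ?case
  proof (cases "\<exists>x\<in>X. w x = 0")
    case True
    then obtain z where z: "z \<in> X" "w z = 0" by blast
    have "card (X - {z}) < card X" using z(1) less.prems(1) by (rule card_Diff1_less[rotated])
    then obtain Y v where "Y \<subseteq> X - {z}" "\<forall>x\<in>Y. v x > 0" "indep_cols I f Y"
      and eq: "\<forall>i\<in>I. (\<Sum>x\<in>Y. v x * f i x) = (\<Sum>x\<in>X - {z}. w x * f i x)"
      using less.hyps[of "X - {z}" w] less.prems by auto
    moreover have "(\<Sum>x\<in>X - {z}. w x * f i x) = (\<Sum>x\<in>X. w x * f i x)" for i
      using z less.prems(1) by (simp add: sum.remove[of X z])
    ultimately show ?thesis by (intro exI[of _ Y] exI[of _ v]) auto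
  next
    case False
    with less.prems have w: "\<And>x. x \<in> X \<Longrightarrow> w x > 0" by force
    show ?thesis
    proof (cases "indep_cols I f X")
      case True
      with w show ?thesis by blast
    next
      case False
      then obtain b' y where b': "\<And>i. i \<in> I \<Longrightarrow> (\<Sum>x\<in>X. b' x * f i x) = 0" and y: "y \<in> X" "b' y \<noteq> 0"
        unfolding indep_cols_def by blast
      \<comment> \<open>The sign is chosen so that some coefficient of the relation is positive.\<close>
      define b where "b x = (if b' y > 0 then b' x else - b' x)" for x
      have b: "(\<Sum>x\<in>X. b x * f i x) = 0" if "i \<in> I" for i
        using b'[OF that] by (cases "b' y > 0") (simp_all add: b_def sum_negf)
      define P where "P = {x \<in> X. b x > 0}"
      have P: "finite P" "P \<noteq> {}" using less.prems(1) y by (auto simp: P_def b_def)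
      \<comment> \<open>The largest \<open>s\<close> for which \<open>w - s b\<close> stays nonnegative; the minimum is attained at an atom \<open>z\<close> whose
        new weight is \<open>0\<close>.\<close>
      define s where "s = Min ((\<lambda>x. w x / b x) ` P)"
      have "s \<in> (\<lambda>x. w x / b x) ` P" unfolding s_def using P by (intro Min_in) auto
      then obtain z where z: "z \<in> X" "b z > 0" "s = w z / b z" by (auto simp: P_def)
      have s_le: "s \<le> w x / b x" if "x \<in> P" for x
        unfolding s_def using P that by (intro Min_le) auto
      have "s \<ge> 0" using z w[OF z(1)] by simp
      define u where "u x = w x - s * b x" for x
      have uz: "u z = 0" using z by (simp add: u_def)
      have u_nn: "u x \<ge> 0" if "x \<in> X" for x
      proof (cases "b x > 0")
        case True
        then have "s \<le> w x / b x" using s_le that by (simp add: P_def)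
        with True show ?thesis by (simp add: u_def pos_le_divide_eq)
      next
        case False
        then have "s * b x \<le> 0" using \<open>s \<ge> 0\<close> by (simp add: mult_nonneg_nonpos)
        with w[OF that] show ?thesis by (simp add: u_def)
      qed
      have u_sum: "(\<Sum>x\<in>X - {z}. u x * f i x) = (\<Sum>x\<in>X. w x * f i x)" if "i \<in> I" for i
      proof -
        have "(\<Sum>x\<in>X - {z}. u x * f i x) = (\<Sum>x\<in>X. u x * f i x)"
          using uz z(1) less.prems(1) by (simp add: sum.remove[of X z])
        also have "\<dots> = (\<Sum>x\<in>X. w x * f i x) - s * (\<Sum>x\<in>X. b x * f i x)"
          by (simp add: u_def left_diff_distrib sum_subtractf sum_distrib_left mult.assoc)
        finally show ?thesis using b[OF that] by simp
      qed
      have "card (X - {z}) < card X" using z(1) less.prems(1) by (rule card_Diff1_less[rotated])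
      then obtain Y v where "Y \<subseteq> X - {z}" "\<forall>x\<in>Y. v x > 0" "indep_cols I f Y"
        and "\<forall>i\<in>I. (\<Sum>x\<in>Y. v x * f i x) = (\<Sum>x\<in>X - {z}. u x * f i x)"
        using less.hyps[of "X - {z}" u] less.prems(1) u_nn by auto
      with u_sum show ?thesis by (intro exI[of _ Y] exI[of _ v]) auto
    qed
  qed
qed

section \<open>Monomials and linear functionals on polynomials\<close>

lemma lookup_const_poly_mult: "Poly_Mapping.lookup (const_poly c * p) \<alpha> = c * Poly_Mapping.lookup p \<alpha>"
proof -
  have "Poly_Mapping.lookup (const_poly c * p) \<alpha> =
      Sum_any (\<lambda>l :: expo. (c * Sum_any (\<lambda>q. Poly_Mapping.lookup p q when \<alpha> = q)) when l = 0)"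
    unfolding lookup_mult const_poly_def by (rule Sum_any.cong) (auto simp: lookup_single when_def)
  also have "\<dots> = c * Poly_Mapping.lookup p \<alpha>" by simp
  finally show ?thesis .
qed

lemma keys_const_poly_mult: "Poly_Mapping.keys (const_poly c * p) \<subseteq> Poly_Mapping.keys p"
  by (auto simp: in_keys_iff lookup_const_poly_mult)

lemma single_eq_const_poly_mult_mono_poly: "Poly_Mapping.single \<alpha> c = const_poly c * mono_poly \<alpha>"
  by (simp add: const_poly_def mono_poly_def mult_single)

lemma keys_mono_poly [simp]: "Poly_Mapping.keys (mono_poly \<alpha>) = {\<alpha>}"
  by (simp add: mono_poly_def)

lemma keys_expo_add: "Poly_Mapping.keys (\<alpha> + \<beta> :: expo) = Poly_Mapping.keys \<alpha> \<union> Poly_Mapping.keys \<beta>"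
  by (auto simp: in_keys_iff lookup_add)

lemma expo_deg_eq_sum: 
  assumes "finite S" "Poly_Mapping.keys \<alpha> \<subseteq> S"
  shows "expo_deg \<alpha> = (\<Sum>i\<in>S. Poly_Mapping.lookup \<alpha> i)"
  unfolding expo_deg_def using assms by (intro sum.mono_neutral_left) (auto simp: in_keys_iff)

lemma expo_deg_add: "expo_deg (\<alpha> + \<beta>) = expo_deg \<alpha> + expo_deg \<beta>"
proof -
  let ?S = "Poly_Mapping.keys \<alpha> \<union> Poly_Mapping.keys \<beta>"
  have "expo_deg (\<alpha> + \<beta>) = (\<Sum>i\<in>?S. Poly_Mapping.lookup (\<alpha> + \<beta>) i)"
    by (rule expo_deg_eq_sum) (auto simp: keys_expo_add)
  also have "\<dots> = expo_deg \<alpha> + expo_deg \<beta>"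
    by (subst (1 2) expo_deg_eq_sum[where S = ?S]) (auto simp: lookup_add sum.distrib)
  finally show ?thesis .
qed

lemma expos_le_add: "\<alpha> \<in> expos_le n k \<Longrightarrow> \<beta> \<in> expos_le n l \<Longrightarrow> \<alpha> + \<beta> \<in> expos_le n (k + l)"
  by (auto simp: expos_le_def keys_expo_add expo_deg_add)

lemma expos_le_mono: "k \<le> l \<Longrightarrow> expos_le n k \<subseteq> expos_le n l"
  by (auto simp: expos_le_def)

lemma mono_poly_in_polys_le [simp]: "mono_poly \<alpha> \<in> polys_le n k \<longleftrightarrow> \<alpha> \<in> expos_le n k"
  by (simp add: polys_le_def)

lemma polys_le_subset_polys: "polys_le n k \<subseteq> polys n"
  by (auto simp: polys_le_def polys_def expos_le_def)

text \<open>
  Functionals are unrestricted outside their domain, so the expansion into monomials needs all partial sums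
  to stay in the domain; it is stated for a domain spanned by an arbitrary set \<open>A\<close> of monomials, which
  covers bounded and unbounded degree.
\<close>

lemma linear_functional_expansion:
  assumes "linear_functional_on {p. Poly_Mapping.keys p \<subseteq> A} L" and "Poly_Mapping.keys p \<subseteq> A"
  shows "L p = (\<Sum>\<alpha>\<in>Poly_Mapping.keys p. Poly_Mapping.lookup p \<alpha> * L (mono_poly \<alpha>))"
proof -
  let ?V = "{p. Poly_Mapping.keys p \<subseteq> A}"
  have add: "L (p + q) = L p + L q" if "p \<in> ?V" "q \<in> ?V" for p q
    using assms(1) that unfolding linear_functional_on_def by blast
  have scale: "L (const_poly c * p) = c * L p" if "p \<in> ?V" for p c
    using assms(1) that unfolding linear_functional_on_def by blast
  have zero: "L 0 = 0" using scale[of 0 0] by simp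
  let ?t = "\<lambda>\<alpha>. Poly_Mapping.single \<alpha> (Poly_Mapping.lookup p \<alpha>)"
  have mem: "(\<Sum>\<alpha>\<in>S. ?t \<alpha>) \<in> ?V" if "S \<subseteq> A" for S
    using keys_sum[of ?t S] that by (auto split: if_splits)
  have "L (\<Sum>\<alpha>\<in>S. ?t \<alpha>) = (\<Sum>\<alpha>\<in>S. Poly_Mapping.lookup p \<alpha> * L (mono_poly \<alpha>))"
    if "finite S" "S \<subseteq> A" for S
    using that
  proof (induction rule: finite_induct)
    case empty
    show ?case by (simp add: zero)
  next
    case (insert \<alpha> S)
    have "mono_poly \<alpha> \<in> ?V" "?t \<alpha> \<in> ?V" using insert.prems by auto
    then have "L (?t \<alpha> + (\<Sum>\<alpha>\<in>S. ?t \<alpha>)) = Poly_Mapping.lookup p \<alpha> * L (mono_poly \<alpha>) + L (\<Sum>\<alpha>\<in>S. ?t \<alpha>)"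
      using add[OF _ mem] scale insert.prems by (simp add: single_eq_const_poly_mult_mono_poly)
    with insert show ?case by simp
  qed
  moreover have "(\<Sum>\<alpha>\<in>Poly_Mapping.keys p. Poly_Mapping.single \<alpha> (Poly_Mapping.lookup p \<alpha>)) = p"
  proof (rule poly_mapping_eqI)
    fix \<beta>
    have "Poly_Mapping.lookup (\<Sum>\<alpha>\<in>Poly_Mapping.keys p. Poly_Mapping.single \<alpha> (Poly_Mapping.lookup p \<alpha>)) \<beta>
       = (\<Sum>\<alpha>\<in>Poly_Mapping.keys p. if \<alpha> = \<beta> then Poly_Mapping.lookup p \<alpha> else 0)"
      by (auto simp: lookup_sum lookup_single when_def intro!: sum.cong)
    also have "\<dots> = Poly_Mapping.lookup p \<beta>" by (auto simp: in_keys_iff)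
    finally show "Poly_Mapping.lookup (\<Sum>\<alpha>\<in>Poly_Mapping.keys p. Poly_Mapping.single \<alpha> (Poly_Mapping.lookup p \<alpha>)) \<beta>
       = Poly_Mapping.lookup p \<beta>" .
  qed
  ultimately show ?thesis using assms(2) by (metis finite_keys)
qed

lemma eval_mono_poly:
  "eval_poly x (mono_poly \<alpha>) = (\<Prod>i\<in>Poly_Mapping.keys \<alpha>. x i ^ Poly_Mapping.lookup \<alpha> i)"
  by (simp add: eval_poly_def mono_poly_def)

lemma eval_poly_eq_sum:
  assumes "finite S" "Poly_Mapping.keys p \<subseteq> S"
  shows "eval_poly x p = (\<Sum>\<alpha>\<in>S. Poly_Mapping.lookup p \<alpha> * eval_poly x (mono_poly \<alpha>))"
  unfolding eval_poly_def[of x p] eval_mono_poly[symmetric]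
  using assms by (intro sum.mono_neutral_left) (auto simp: in_keys_iff)

lemma eval_poly_add: "eval_poly x (p + q) = eval_poly x p + eval_poly x q"
proof -
  let ?S = "Poly_Mapping.keys p \<union> Poly_Mapping.keys q"
  have "eval_poly x (p + q) = (\<Sum>\<alpha>\<in>?S. Poly_Mapping.lookup (p + q) \<alpha> * eval_poly x (mono_poly \<alpha>))"
    by (intro eval_poly_eq_sum keys_add) auto
  also have "\<dots> = eval_poly x p + eval_poly x q"
    by (subst (1 2) eval_poly_eq_sum[where S = ?S]) (auto simp: lookup_add sum.distrib distrib_right)
  finally show ?thesis .
qed

lemma eval_poly_const_mult: "eval_poly x (const_poly c * p) = c * eval_poly x p"
proof -
  have "eval_poly x (const_poly c * p) =
      (\<Sum>\<alpha>\<in>Poly_Mapping.keys p. Poly_Mapping.lookup (const_poly c * p) \<alpha> * eval_poly x (mono_poly \<alpha>))"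
    using keys_const_poly_mult by (intro eval_poly_eq_sum) auto
  then show ?thesis
    by (simp add: eval_poly_eq_sum[of "Poly_Mapping.keys p" p] lookup_const_poly_mult sum_distrib_left mult.assoc)
qed

lemma eval_mono_poly_eq_prod:
  assumes "finite S" "Poly_Mapping.keys \<alpha> \<subseteq> S"
  shows "eval_poly x (mono_poly \<alpha>) = (\<Prod>i\<in>S. x i ^ Poly_Mapping.lookup \<alpha> i)"
  unfolding eval_mono_poly using assms by (intro prod.mono_neutral_left) (auto simp: in_keys_iff)

lemma eval_mono_poly_add:
  "eval_poly x (mono_poly (\<alpha> + \<beta>)) = eval_poly x (mono_poly \<alpha>) * eval_poly x (mono_poly \<beta>)"
proof -
  let ?S = "Poly_Mapping.keys \<alpha> \<union> Poly_Mapping.keys \<beta>"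
  have "eval_poly x (mono_poly (\<alpha> + \<beta>)) = (\<Prod>i\<in>?S. x i ^ Poly_Mapping.lookup (\<alpha> + \<beta>) i)"
    by (rule eval_mono_poly_eq_prod) (auto simp: keys_expo_add)
  also have "\<dots> = eval_poly x (mono_poly \<alpha>) * eval_poly x (mono_poly \<beta>)"
    by (subst (1 2) eval_mono_poly_eq_prod[where S = ?S]) (auto simp: lookup_add power_add prod.distrib)
  finally show ?thesis .
qed

lemma measurable_eval_poly:
  assumes "p \<in> polys n"
  shows "(\<lambda>x. eval_poly x p) \<in> borel_measurable (Pi\<^sub>M {..<n} (\<lambda>_. borel))"
proof -
  have "(\<lambda>x. x i :: real) \<in> borel_measurable (Pi\<^sub>M {..<n} (\<lambda>_. borel))"
    if "\<alpha> \<in> Poly_Mapping.keys p" "i \<in> Poly_Mapping.keys \<alpha>" for \<alpha> i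
    using assms that by (intro measurable_component_singleton) (auto simp: polys_def)
  then show ?thesis unfolding eval_poly_def by measurable
qed

section \<open>Hankel ranks and relations of flat extensions\<close>

lemma hankel_rank_eq_card_col_basis:
  "\<exists>J. col_basis (expos_le n D) (\<lambda>\<alpha> \<beta>. L (mono_poly (\<alpha> + \<beta>))) (expos_le n D) J \<and>
       hankel_rank n D L = card J"
proof -
  define as where "as = sorted_list_of_set (expos_le n D)"
  have as: "distinct as" "set as = expos_le n D" "length as = card (expos_le n D)"
    by (auto simp: as_def finite_expos_le)
  show ?thesis
    using rank_eq_card_col_basis[OF as(1), of "\<lambda>\<alpha> \<beta>. L (mono_poly (\<alpha> + \<beta>))"]
    unfolding hankel_rank_def hankel_def Let_def as_def[symmetric] as(2) as(3)[symmetric] .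
qed

text \<open>
  When the rank does not grow, a column basis in degree \<open>D\<close> is still one in degree \<open>D + 1\<close>, with rows of
  degree up to \<open>D + 1\<close>. By symmetry a polynomial orthogonal to everything of degree \<open>\<le> D\<close> is then
  orthogonal to the monomials \<open>x\<^sup>\<gamma>\<close> of degree \<open>\<le> D + 1\<close>, whose columns are combinations of the basis.
\<close>

lemma hankel_kernel_extends:
  assumes rank: "hankel_rank n (D + 1) L = hankel_rank n D L"
    and S: "S \<subseteq> expos_le n D"
    and ker: "\<And>\<beta>. \<beta> \<in> expos_le n D \<Longrightarrow> (\<Sum>\<alpha>\<in>S. c \<alpha> * L (mono_poly (\<alpha> + \<beta>))) = 0"
    and \<gamma>: "\<gamma> \<in> expos_le n (D + 1)"
  shows "(\<Sum>\<alpha>\<in>S. c \<alpha> * L (mono_poly (\<alpha> + \<gamma>))) = 0"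
proof -
  let ?E = "expos_le n D" and ?E' = "expos_le n (D + 1)"
  let ?H = "\<lambda>\<alpha> \<beta>. L (mono_poly (\<alpha> + \<beta>))"
  have EE': "?E \<subseteq> ?E'" by (rule expos_le_mono) simp
  obtain J where J: "col_basis ?E ?H ?E J" "hankel_rank n D L = card J"
    using hankel_rank_eq_card_col_basis by blast
  obtain J' where J': "col_basis ?E' ?H ?E' J'" "hankel_rank n (D + 1) L = card J'"
    using hankel_rank_eq_card_col_basis by blast
  have JE: "J \<subseteq> ?E" and J'E: "J' \<subseteq> ?E'" using J(1) J'(1) by (auto simp: col_basis_def)
  have fin: "finite J" "finite J'" using JE J'E finite_expos_le finite_subset by blast+
  have ind: "indep_cols ?E' ?H J"
    using J(1) indep_cols_mono_rows[OF _ EE'] by (auto simp: col_basis_def)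
  have "spanned_by_cols ?E' ?H J \<gamma>"
  proof (cases "\<gamma> \<in> J")
    case True
    then show ?thesis using fin(1) unfolding spanned_by_cols_def
      by (intro exI[of _ "\<lambda>l. of_bool (l = \<gamma>)"]) (simp add: of_bool_def if_distrib[of "\<lambda>x. x * _"] cong: if_cong)
  next
    case False
    \<comment> \<open>Otherwise the rank in degree \<open>D + 1\<close> would exceed \<open>card J\<close>.\<close>
    have "\<not> indep_cols ?E' ?H (insert \<gamma> J)"
    proof
      assume "indep_cols ?E' ?H (insert \<gamma> J)"
      moreover have "spanned_by_cols ?E' ?H J' k" if "k \<in> insert \<gamma> J" for k
        using J'(1) that \<gamma> JE EE' by (auto simp: col_basis_def)
      ultimately have "card (insert \<gamma> J) \<le> card J'"
        using fin by (intro card_indep_le_card_spanning) auto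
      with False fin rank J(2) J'(2) show False by simp
    qed
    with fin(1) ind show ?thesis by (rule spanned_if_not_indep_insert)
  qed
  then obtain a where a: "\<And>\<alpha>. \<alpha> \<in> ?E' \<Longrightarrow> ?H \<alpha> \<gamma> = (\<Sum>\<beta>\<in>J. a \<beta> * ?H \<alpha> \<beta>)"
    unfolding spanned_by_cols_def by blast
  have "(\<Sum>\<alpha>\<in>S. c \<alpha> * ?H \<alpha> \<gamma>) = (\<Sum>\<alpha>\<in>S. \<Sum>\<beta>\<in>J. a \<beta> * (c \<alpha> * ?H \<alpha> \<beta>))"
    using S EE' by (intro sum.cong) (auto simp: a sum_distrib_left mult.left_commute)
  also have "\<dots> = (\<Sum>\<beta>\<in>J. a \<beta> * (\<Sum>\<alpha>\<in>S. c \<alpha> * ?H \<alpha> \<beta>))"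
    by (subst sum.swap) (simp add: sum_distrib_left)
  also have "\<dots> = 0" using ker JE by (auto intro!: sum.neutral)
  finally show ?thesis .
qed

text \<open>
  The previous lemma for the binomial \<open>x\<^sup>\<alpha> - x\<^sup>\<alpha>'\<close>, iterated over all degrees: a flat extension vanishes
  on the ideal generated by the binomials in the kernel.
\<close>

lemma hankel_relation_extends:
  assumes flat: "flat_extension n D Linf L\<^sub>0"
    and \<alpha>: "\<alpha> \<in> expos_le n D" "\<alpha>' \<in> expos_le n D"
    and rel: "\<And>\<beta>. \<beta> \<in> expos_le n D \<Longrightarrow> L\<^sub>0 (mono_poly (\<alpha> + \<beta>)) = L\<^sub>0 (mono_poly (\<alpha>' + \<beta>))"
    and \<beta>: "Poly_Mapping.keys \<beta> \<subseteq> {..<n}"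
  shows "Linf (mono_poly (\<alpha> + \<beta>)) = Linf (mono_poly (\<alpha>' + \<beta>))"
proof (cases "\<alpha> = \<alpha>'")
  case False
  define c where "c \<gamma> = (if \<gamma> = \<alpha> then 1 else - 1 :: real)" for \<gamma>
  have c: "(\<Sum>\<gamma>\<in>{\<alpha>, \<alpha>'}. c \<gamma> * Linf (mono_poly (\<gamma> + \<beta>))) =
      Linf (mono_poly (\<alpha> + \<beta>)) - Linf (mono_poly (\<alpha>' + \<beta>))" for \<beta>
    using False by (simp add: c_def)
  have ext: "Linf (mono_poly (\<gamma> + \<beta>)) = L\<^sub>0 (mono_poly (\<gamma> + \<beta>))" 
    if "\<gamma> \<in> expos_le n D" "\<beta> \<in> expos_le n D" for \<gamma> \<beta>
    using flat expos_le_add[OF that] unfolding flat_extension_def extends_on_def by (simp add: mult_2)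
  have "(\<Sum>\<gamma>\<in>{\<alpha>, \<alpha>'}. c \<gamma> * Linf (mono_poly (\<gamma> + \<beta>))) = 0" if "D \<le> k" "\<beta> \<in> expos_le n k" for k \<beta>
    using that
  proof (induction k arbitrary: \<beta> rule: dec_induct)
    case base
    then show ?case unfolding c by (simp add: ext rel \<alpha>)
  next
    case (step k)
    have "hankel_rank n (k + 1) Linf = hankel_rank n k Linf"
      using flat step.hyps unfolding flat_extension_def flat_def by blast
    moreover have "{\<alpha>, \<alpha>'} \<subseteq> expos_le n k" using \<alpha> expos_le_mono[OF step.hyps(1)] by blast
    ultimately show ?case
    proof (rule hankel_kernel_extends)
      show "(\<Sum>\<gamma>\<in>{\<alpha>, \<alpha>'}. c \<gamma> * Linf (mono_poly (\<gamma> + \<beta>'))) = 0" if "\<beta>' \<in> expos_le n k" for \<beta>'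
        using that by (rule step.IH)
      show "\<beta> \<in> expos_le n (k + 1)" using step.prems by simp
    qed
  qed
  from this[of "max D (expo_deg \<beta>)" \<beta>] \<beta> show ?thesis unfolding c by (simp add: expos_le_def)
qed simp

lemma hankel_rank_flat_extension:
  assumes "flat_extension n D Linf L\<^sub>0" "D \<le> k"
  shows "hankel_rank n k Linf = hankel_rank n D Linf"
  using assms(2)
proof (induction k rule: dec_induct)
  case (step k)
  then show ?case using assms(1) unfolding flat_extension_def flat_def by simp
qed simp

lemma hankel_rank_le_card: "hankel_rank n D L \<le> card (expos_le n D)"
proof -
  obtain J where "col_basis (expos_le n D) (\<lambda>\<alpha> \<beta>. L (mono_poly (\<alpha> + \<beta>))) (expos_le n D) J" "hankel_rank n D L = card J"
    using hankel_rank_eq_card_col_basis by blast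
  then show ?thesis using card_mono[OF finite_expos_le] by (auto simp: col_basis_def)
qed

section \<open>Finitely atomic functionals\<close>

definition atomic_functional :: "(nat \<Rightarrow> real) set \<Rightarrow> ((nat \<Rightarrow> real) \<Rightarrow> real) \<Rightarrow> rpoly \<Rightarrow> real" where
  "atomic_functional X w p = (\<Sum>x\<in>X. w x * eval_poly x p)"

lemma linear_functional_atomic: "linear_functional_on V (atomic_functional X w)"
  unfolding linear_functional_on_def atomic_functional_def
  by (auto simp: eval_poly_add eval_poly_const_mult distrib_left sum.distrib sum_distrib_left
      mult.left_commute)

lemma moment_functional_atomic:
  assumes X: "finite X" "X \<subseteq> space (Pi\<^sub>M {..<n} (\<lambda>_. borel :: real measure))"
    and w: "\<And>x. x \<in> X \<Longrightarrow> w x \<ge> 0"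
  shows "moment_functional n k (atomic_functional X w)"
proof -
  let ?P = "Pi\<^sub>M {..<n} (\<lambda>_. borel :: real measure)"
  \<comment> \<open>The point measure lives on the discrete space \<open>X\<close>; its image has the Borel sets of the whole space.\<close>
  define \<mu> where "\<mu> = distr (point_measure X w) ?P (\<lambda>x. x)"
  have id[measurable]: "(\<lambda>x. x) \<in> measurable (point_measure X w) ?P"
    using X(2) by (simp add: measurable_def sets_point_measure space_point_measure subset_iff)
  have "integrable \<mu> (\<lambda>x. eval_poly x p) \<and> atomic_functional X w p = (\<integral>x. eval_poly x p \<partial>\<mu>)"
    if "p \<in> polys_le n k" for p
  proof -
    have m: "(\<lambda>x. eval_poly x p) \<in> borel_measurable ?P"
      using that polys_le_subset_polys by (intro measurable_eval_poly) auto
    show ?thesis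
      unfolding \<mu>_def integral_distr[OF id m] integrable_distr_eq[OF id m] atomic_functional_def
      by (simp add: integrable_point_measure_finite lebesgue_integral_point_measure_finite X(1) w)
  qed
  moreover have "sets \<mu> = sets ?P" by (simp add: \<mu>_def)
  ultimately show ?thesis unfolding moment_functional_def using linear_functional_atomic by blast
qed

lemma hankel_rank_atomic:
  assumes "finite X" "\<And>x. x \<in> X \<Longrightarrow> w x \<noteq> 0"
    and "indep_cols (expos_le n D) (\<lambda>\<alpha> x. eval_poly x (mono_poly \<alpha>)) X"
    and L: "\<And>\<alpha> \<beta>. \<alpha> \<in> expos_le n D \<Longrightarrow> \<beta> \<in> expos_le n D \<Longrightarrow>
        L (mono_poly (\<alpha> + \<beta>)) = atomic_functional X w (mono_poly (\<alpha> + \<beta>))"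
  shows "hankel_rank n D L = card X"
proof -
  obtain J where J: "col_basis (expos_le n D) (\<lambda>\<alpha> \<beta>. L (mono_poly (\<alpha> + \<beta>))) (expos_le n D) J"
    and rank: "hankel_rank n D L = card J"
    using hankel_rank_eq_card_col_basis by blast
  have "card J = card X"
    by (rule card_col_basis_weighted_gram[OF finite_expos_le assms(1) assms(3) assms(2) _ J])
       (simp_all add: L atomic_functional_def eval_mono_poly_add mult.assoc)
  with rank show ?thesis by simp
qed

lemma flat_extension_atomic:
  assumes "finite X" "\<And>x. x \<in> X \<Longrightarrow> w x \<noteq> 0"
    and ind: "indep_cols (expos_le n D) (\<lambda>\<alpha> x. eval_poly x (mono_poly \<alpha>)) X"
  shows "flat_extension n D (atomic_functional X w) (atomic_functional X w)"
proof -
  have "hankel_rank n D' (atomic_functional X w) = card X" if "D \<le> D'" for D'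
    using assms(1,2) indep_cols_mono_rows[OF ind expos_le_mono[OF that]]
    by (rule hankel_rank_atomic) simp_all
  then show ?thesis
    unfolding flat_extension_def flat_def extends_on_def using linear_functional_atomic by auto
qed

text \<open>
  The evaluations at the atoms are chosen independent already on degree \<open>\<le> k\<close>; this is why the Hankel
  rank is constant from \<open>D = k\<close> on. The extension is a moment functional in every degree, being given by
  the same atoms.
\<close>

lemma moment_functional_has_flat_extension:
  assumes L: "moment_functional n k L"
  shows "\<exists>L0. extends_on (polys_le n k) L0 L \<and> (\<forall>l. moment_functional n l L0) \<and> flat_extension n k L0 L0"
proof -
  let ?P = "Pi\<^sub>M {..<n} (\<lambda>_. borel :: real measure)" and ?E = "expos_le n k"
  let ?V = "\<lambda>\<alpha> x. eval_poly x (mono_poly \<alpha>)"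
  obtain \<mu> where sets: "sets \<mu> = sets ?P" 
    and int: "\<And>p. p \<in> polys_le n k \<Longrightarrow> integrable \<mu> (\<lambda>x. eval_poly x p)"
    and L_int: "\<And>p. p \<in> polys_le n k \<Longrightarrow> L p = (\<integral>x. eval_poly x p \<partial>\<mu>)"
    using L unfolding moment_functional_def by blast
  have space: "space \<mu> = space ?P" using sets by (rule sets_eq_imp_space_eq)
  obtain X w where X: "finite X" "X \<subseteq> space \<mu>" "\<forall>x\<in>X. w x \<ge> 0"
    and eq: "\<And>\<alpha>. \<alpha> \<in> ?E \<Longrightarrow> (\<integral>x. ?V \<alpha> x \<partial>\<mu>) = (\<Sum>x\<in>X. w x * ?V \<alpha> x)"
    using integral_in_cone_of_values[of ?E \<mu> ?V "space \<mu>"] int finite_expos_le by auto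
  obtain Y v where Y: "Y \<subseteq> X" "\<forall>x\<in>Y. v x > 0" "indep_cols ?E ?V Y"
    and eq': "\<And>\<alpha>. \<alpha> \<in> ?E \<Longrightarrow> (\<Sum>x\<in>Y. v x * ?V \<alpha> x) = (\<Sum>x\<in>X. w x * ?V \<alpha> x)"
    using exists_indep_positive_representation[of X w ?E ?V] X by auto
  have finY: "finite Y" using Y(1) X(1) finite_subset by blast
  let ?L0 = "atomic_functional Y v"
  have mono: "?L0 (mono_poly \<alpha>) = L (mono_poly \<alpha>)" if "\<alpha> \<in> ?E" for \<alpha>
    using that by (simp add: atomic_functional_def eq eq' L_int)
  have "?L0 p = L p" if "p \<in> polys_le n k" for p
  proof -
    have lin: "linear_functional_on {p. Poly_Mapping.keys p \<subseteq> ?E} L"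
      using L unfolding moment_functional_def polys_le_def by blast
    have "Poly_Mapping.keys p \<subseteq> ?E" using that by (simp add: polys_le_def)
    with linear_functional_expansion[OF lin this] 
      linear_functional_expansion[OF linear_functional_atomic this, of Y v] mono
    show ?thesis by (auto intro!: sum.cong)
  qed
  moreover have "moment_functional n l ?L0" for l
    using Y X space finY by (intro moment_functional_atomic) (auto intro: less_imp_le)
  moreover have "flat_extension n k ?L0 ?L0"
    using Y finY by (intro flat_extension_atomic) force+
  ultimately show ?thesis unfolding extends_on_def by blast
qed

section \<open>Functionals vanishing on the Boolean relations\<close>

lemma eval_mono_poly_single: "eval_poly x (mono_poly (Poly_Mapping.single i k)) = x i ^ k"
  by (cases "k = 0") (auto simp: eval_mono_poly)

lemma single_in_expos_le: "i < n \<Longrightarrow> k \<le> l \<Longrightarrow> Poly_Mapping.single i k \<in> expos_le n l"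
  by (auto simp: expos_le_def expo_deg_def)

text \<open>
  The hypothesis \<open>zero\<close> says that \<open>(x\<^sub>i\<^sup>2 - x\<^sub>i)\<^sup>2\<close> has integral \<open>0\<close> for a representing measure, so
  \<open>x\<^sub>i\<^sup>2 = x\<^sub>i\<close> holds almost everywhere.
\<close>

lemma moment_functional_boolean_relation:
  assumes L: "moment_functional n (2 * D) L" and D: "D \<ge> 2" and i: "i < n"
    and zero: "L (mono_poly (Poly_Mapping.single i 4)) - 2 * L (mono_poly (Poly_Mapping.single i 3))
                + L (mono_poly (Poly_Mapping.single i 2)) = 0"
    and \<beta>: "\<beta> \<in> expos_le n D"
  shows "L (mono_poly (Poly_Mapping.single i 2 + \<beta>)) = L (mono_poly (Poly_Mapping.single i 1 + \<beta>))"
proof -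
  obtain \<mu> where int: "\<And>p. p \<in> polys_le n (2 * D) \<Longrightarrow> integrable \<mu> (\<lambda>x. eval_poly x p)"
    and L_int: "\<And>p. p \<in> polys_le n (2 * D) \<Longrightarrow> L p = (\<integral>x. eval_poly x p \<partial>\<mu>)"
    using L unfolding moment_functional_def by blast
  have pow: "integrable \<mu> (\<lambda>x. x i ^ k)" "L (mono_poly (Poly_Mapping.single i k)) = (\<integral>x. x i ^ k \<partial>\<mu>)"
    if "k \<le> 4" for k
    using int[of "mono_poly (Poly_Mapping.single i k)"] L_int[of "mono_poly (Poly_Mapping.single i k)"]
      single_in_expos_le[OF i, of k "2 * D"] that D by (simp_all add: eval_mono_poly_single)
  have sq: "(x i ^ 2 - x i)\<^sup>2 = x i ^ 4 - 2 * x i ^ 3 + x i ^ 2" for x :: "nat \<Rightarrow> real"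
    by (simp add: power2_diff power2_eq_square power3_eq_cube numeral_eq_Suc algebra_simps)
  have "(\<integral>x. (x i ^ 2 - x i)\<^sup>2 \<partial>\<mu>) = 0"
    using zero pow by (simp add: sq)
  moreover have "integrable \<mu> (\<lambda>x. (x i ^ 2 - x i)\<^sup>2)"
    unfolding sq using pow by simp
  ultimately have AE: "AE x in \<mu>. (x i ^ 2 - x i)\<^sup>2 = 0"
    by (subst (asm) integral_nonneg_eq_0_iff_AE) auto
  have mem: "mono_poly (Poly_Mapping.single i k + \<beta>) \<in> polys_le n (2 * D)" if "k \<le> 2" for k
    using expos_le_add[OF single_in_expos_le[OF i, of k D] \<beta>] that D by (simp add: mult_2)
  have "(\<integral>x. eval_poly x (mono_poly (Poly_Mapping.single i 2 + \<beta>)) \<partial>\<mu>)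
      = (\<integral>x. eval_poly x (mono_poly (Poly_Mapping.single i 1 + \<beta>)) \<partial>\<mu>)"
  proof (rule integral_cong_AE)
    have "(\<lambda>x. eval_poly x (mono_poly (Poly_Mapping.single i k + \<beta>))) \<in> borel_measurable \<mu>"
      if "k \<le> 2" for k using int[OF mem[OF that]] by (rule borel_measurable_integrable)
    then show "(\<lambda>x. eval_poly x (mono_poly (Poly_Mapping.single i 2 + \<beta>))) \<in> borel_measurable \<mu>"
      "(\<lambda>x. eval_poly x (mono_poly (Poly_Mapping.single i 1 + \<beta>))) \<in> borel_measurable \<mu>" by simp_all
    show "AE x in \<mu>. eval_poly x (mono_poly (Poly_Mapping.single i 2 + \<beta>))
        = eval_poly x (mono_poly (Poly_Mapping.single i 1 + \<beta>))"
      using AE by eventually_elim (simp add: eval_mono_poly_add eval_mono_poly_single)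
  qed
  then show ?thesis using L_int mem by simp
qed

definition squarefree_expo :: "nat set \<Rightarrow> expo" where
  "squarefree_expo A = (\<Sum>i\<in>A. Poly_Mapping.single i 1)"

lemma lookup_squarefree_expo: "finite A \<Longrightarrow> Poly_Mapping.lookup (squarefree_expo A) i = of_bool (i \<in> A)"
  by (simp add: squarefree_expo_def lookup_sum lookup_single when_def of_bool_def)

lemma keys_squarefree_expo [simp]: "finite A \<Longrightarrow> Poly_Mapping.keys (squarefree_expo A) = A"
  by (auto simp: in_keys_iff lookup_squarefree_expo)

lemma expo_deg_squarefree_expo: "finite A \<Longrightarrow> expo_deg (squarefree_expo A) = card A"
  by (simp add: expo_deg_def lookup_squarefree_expo)

text \<open>
  Replacing \<open>x\<^sub>i\<^sup>2\<close> by \<open>x\<^sub>i\<close> keeps the support of a monomial and lowers its degree.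
\<close>

lemma boolean_functional_reduces_to_squarefree:
  assumes "\<And>i \<beta>. i < n \<Longrightarrow> Poly_Mapping.keys \<beta> \<subseteq> {..<n} \<Longrightarrow>
      L (mono_poly (Poly_Mapping.single i 2 + \<beta>)) = L (mono_poly (Poly_Mapping.single i 1 + \<beta>))"
    and "Poly_Mapping.keys \<alpha> \<subseteq> {..<n}"
  shows "L (mono_poly \<alpha>) = L (mono_poly (squarefree_expo (Poly_Mapping.keys \<alpha>)))"
  using assms(2)
proof (induction "expo_deg \<alpha>" arbitrary: \<alpha> rule: less_induct)
  case less
  show ?case
  proof (cases "\<exists>i. Poly_Mapping.lookup \<alpha> i \<ge> 2")
    case False
    have "Poly_Mapping.lookup \<alpha> i = of_bool (i \<in> Poly_Mapping.keys \<alpha>)" for i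
    proof -
      have "Poly_Mapping.lookup \<alpha> i < 2" using False by (simp add: not_le)
      then show ?thesis unfolding in_keys_iff of_bool_def by (split if_split) presburger
    qed
    then have "squarefree_expo (Poly_Mapping.keys \<alpha>) = \<alpha>"
      by (intro poly_mapping_eqI) (simp add: lookup_squarefree_expo)
    then show ?thesis by simp
  next
    case True
    then obtain i where i: "Poly_Mapping.lookup \<alpha> i \<ge> 2" by blast
    define \<beta> where "\<beta> = \<alpha> - Poly_Mapping.single i 2"
    have \<alpha>: "\<alpha> = Poly_Mapping.single i 2 + \<beta>"
      using i by (intro poly_mapping_eqI) (auto simp: \<beta>_def lookup_add lookup_minus lookup_single when_def)
    let ?\<alpha>' = "Poly_Mapping.single i 1 + \<beta>"
    have keys: "Poly_Mapping.keys ?\<alpha>' = Poly_Mapping.keys \<alpha>" by (simp add: \<alpha> keys_expo_add)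
    have "i < n" "Poly_Mapping.keys \<beta> \<subseteq> {..<n}" using less.prems by (auto simp: \<alpha> keys_expo_add)
    then have "L (mono_poly \<alpha>) = L (mono_poly ?\<alpha>')" unfolding \<alpha> by (rule assms(1))
    also have "\<dots> = L (mono_poly (squarefree_expo (Poly_Mapping.keys ?\<alpha>')))"
    proof (rule less.hyps)
      show "expo_deg ?\<alpha>' < expo_deg \<alpha>"
        by (simp add: \<alpha> expo_deg_add expo_deg_def[of "Poly_Mapping.single _ _"])
      show "Poly_Mapping.keys ?\<alpha>' \<subseteq> {..<n}" unfolding keys by (rule less.prems)
    qed
    finally show ?thesis by (simp only: keys)
  qed
qed

text \<open>
  Moebius inversion on the subset lattice, in the existence form: the evaluations at the vertices of the
  cube span all functionals on multilinear polynomials. The induction splits the cube along one coordinate.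
\<close>

lemma exists_superset_sum_representation:
  fixes F :: "'a set \<Rightarrow> real"
  assumes "finite U"
  shows "\<exists>c. \<forall>A\<subseteq>U. F A = (\<Sum>B\<in>Pow U. c B * of_bool (A \<subseteq> B))"
  using assms
proof (induction U arbitrary: F rule: finite_induct)
  case empty
  show ?case by (intro exI[of _ F]) auto
next
  case (insert x U)
  obtain c\<^sub>1 where c1: "\<And>A. A \<subseteq> U \<Longrightarrow> F (insert x A) = (\<Sum>B\<in>Pow U. c\<^sub>1 B * of_bool (A \<subseteq> B))"
    using insert.IH[of "\<lambda>A. F (insert x A)"] by blast
  obtain c\<^sub>0 where c0: "\<And>A. A \<subseteq> U \<Longrightarrow> F A - F (insert x A) = (\<Sum>B\<in>Pow U. c\<^sub>0 B * of_bool (A \<subseteq> B))"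
    using insert.IH[of "\<lambda>A. F A - F (insert x A)"] by blast
  define c where "c B = (if x \<in> B then c\<^sub>1 (B - {x}) else c\<^sub>0 B)" for B
  have split: "(\<Sum>B\<in>Pow (insert x U). c B * of_bool (A \<subseteq> B)) =
      (\<Sum>B\<in>Pow U. c\<^sub>0 B * of_bool (A \<subseteq> B)) + (\<Sum>B\<in>Pow U. c\<^sub>1 B * of_bool (A \<subseteq> insert x B))" for A
  proof -
    have inj: "inj_on (insert x) (Pow U)" using insert.hyps by (auto simp: inj_on_def)
    have "(\<Sum>B\<in>Pow (insert x U). c B * of_bool (A \<subseteq> B)) =
      (\<Sum>B\<in>Pow U. c B * of_bool (A \<subseteq> B)) + (\<Sum>B\<in>insert x ` Pow U. c B * of_bool (A \<subseteq> B))"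
      unfolding Pow_insert using insert.hyps by (intro sum.union_disjoint) auto
    also have "(\<Sum>B\<in>insert x ` Pow U. c B * of_bool (A \<subseteq> B)) = (\<Sum>B\<in>Pow U. c (insert x B) * of_bool (A \<subseteq> insert x B))"
      using sum.reindex[OF inj] by simp
    also have "\<dots> = (\<Sum>B\<in>Pow U. c\<^sub>1 B * of_bool (A \<subseteq> insert x B))"
    proof (intro sum.cong refl)
      fix B assume "B \<in> Pow U"
      then have "insert x B - {x} = B" using insert.hyps by blast
      then show "c (insert x B) * of_bool (A \<subseteq> insert x B) = c\<^sub>1 B * of_bool (A \<subseteq> insert x B)"
        by (simp add: c_def)
    qed
    also have "(\<Sum>B\<in>Pow U. c B * of_bool (A \<subseteq> B)) = (\<Sum>B\<in>Pow U. c\<^sub>0 B * of_bool (A \<subseteq> B))"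
      using insert.hyps by (intro sum.cong) (auto simp: c_def)
    finally show ?thesis .
  qed
  have "F A = (\<Sum>B\<in>Pow (insert x U). c B * of_bool (A \<subseteq> B))" if A: "A \<subseteq> insert x U" for A
  proof (cases "x \<in> A")
    case False
    then have "A \<subseteq> U" "\<And>B. A \<subseteq> insert x B \<longleftrightarrow> A \<subseteq> B" using A by auto
    then show ?thesis unfolding split using c0[of A] c1[of A] by simp
  next
    case True
    then have A': "A - {x} \<subseteq> U" "insert x (A - {x}) = A" "\<And>B. A \<subseteq> insert x B \<longleftrightarrow> A - {x} \<subseteq> B" using A by auto
    have "(\<Sum>B\<in>Pow U. c\<^sub>0 B * of_bool (A \<subseteq> B)) = 0"
      using True insert.hyps by (intro sum.neutral) auto
    then show ?thesis unfolding split using c1[OF A'(1)] A' by simp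
  qed
  then show ?case by blast
qed

text \<open>
  The value of \<open>x\<^sup>\<alpha>\<close> at the vertex \<open>1\<^sub>B\<close> is \<open>1\<close> if \<open>B\<close> contains the support of \<open>\<alpha>\<close> and \<open>0\<close> otherwise.
  Testing a relation of vertex evaluations with the squarefree monomial of a maximal \<open>B\<close> isolates the
  coefficient of \<open>B\<close>.
\<close>

lemma indep_superset_indicators:
  assumes T: "T \<subseteq> Pow {..<n}" and k: "n \<le> k"
  shows "indep_cols (expos_le n k) (\<lambda>\<alpha> B. of_bool (Poly_Mapping.keys \<alpha> \<subseteq> B)) T"
  unfolding indep_cols_def
proof (intro allI impI ballI, rule ccontr)
  fix c :: "nat set \<Rightarrow> real" and B\<^sub>0
  assume c: "\<forall>\<alpha>\<in>expos_le n k. (\<Sum>B\<in>T. c B * of_bool (Poly_Mapping.keys \<alpha> \<subseteq> B)) = 0"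
    and B0: "B\<^sub>0 \<in> T" "c B\<^sub>0 \<noteq> 0"
  have finT: "finite T" using T finite_subset by blast
  have "\<exists>B\<in>{B \<in> T. c B \<noteq> 0}. \<forall>B'\<in>{B \<in> T. c B \<noteq> 0}. B \<subseteq> B' \<longrightarrow> B = B'"
    using finT B0 by (intro finite_has_maximal) auto
  then obtain B where B: "B \<in> T" "c B \<noteq> 0" and max: "\<And>B'. B' \<in> T \<Longrightarrow> B \<subseteq> B' \<Longrightarrow> B' \<noteq> B \<Longrightarrow> c B' = 0"
    by blast
  have finB: "finite B" "card B \<le> n" using B(1) T card_mono[of "{..<n}" B] finite_subset[of B "{..<n}"] by auto
  then have "squarefree_expo B \<in> expos_le n k"
    using B(1) T k by (auto simp: expos_le_def expo_deg_squarefree_expo)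
  then have "0 = (\<Sum>B'\<in>T. c B' * of_bool (B \<subseteq> B'))" using c finB(1) by fastforce
  also have "\<dots> = (\<Sum>B'\<in>T. if B' = B then c B else 0)" using max by (intro sum.cong) auto
  also have "\<dots> = c B" using finT B(1) by simp
  finally show False using B(2) by simp
qed

text \<open>
  The functional \<open>Linf\<close> depends only on the support of an exponent, hence is a combination of evaluations
  at vertices of the cube, the set \<open>B\<close> standing for the vertex \<open>1\<^sub>B\<close>. In degree \<open>n\<close> and above, these
  evaluations are independent and the Hankel rank counts the nonzero coefficients; flatness says that it
  equals the rank in degree \<open>D\<close>.
\<close>

lemma boolean_flat_extension_sparse:
  assumes flat: "flat_extension n D Linf L\<^sub>0" and L0: "moment_functional n (2 * D) L\<^sub>0" and D: "D \<ge> 2"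
    and zero: "\<And>i. i < n \<Longrightarrow> L\<^sub>0 (mono_poly (Poly_Mapping.single i 4))
        - 2 * L\<^sub>0 (mono_poly (Poly_Mapping.single i 3)) + L\<^sub>0 (mono_poly (Poly_Mapping.single i 2)) = 0"
  shows "\<exists>T c. T \<subseteq> Pow {..<n} \<and> card T \<le> card (expos_le n D) \<and>
    (\<forall>\<alpha>. Poly_Mapping.keys \<alpha> \<subseteq> {..<n} \<longrightarrow>
       Linf (mono_poly \<alpha>) = (\<Sum>B\<in>T. c B * of_bool (Poly_Mapping.keys \<alpha> \<subseteq> B)))"
proof -
  have rel: "Linf (mono_poly (Poly_Mapping.single i 2 + \<beta>)) = Linf (mono_poly (Poly_Mapping.single i 1 + \<beta>))"
    if "i < n" "Poly_Mapping.keys \<beta> \<subseteq> {..<n}" for i \<beta>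
    using that D moment_functional_boolean_relation[OF L0 D that(1) zero[OF that(1)]]
    by (intro hankel_relation_extends[OF flat]) (auto intro: single_in_expos_le)
  obtain c where c: "\<And>A. A \<subseteq> {..<n} \<Longrightarrow>
      Linf (mono_poly (squarefree_expo A)) = (\<Sum>B\<in>Pow {..<n}. c B * of_bool (A \<subseteq> B))"
    using exists_superset_sum_representation[of "{..<n}" "\<lambda>A. Linf (mono_poly (squarefree_expo A))"] by blast
  \<comment> \<open>Only the nonzero coefficients count towards the rank.\<close>
  define T where "T = {B \<in> Pow {..<n}. c B \<noteq> 0}"
  have T: "T \<subseteq> Pow {..<n}" "finite T" by (auto simp: T_def)
  have Linf: "Linf (mono_poly \<alpha>) = (\<Sum>B\<in>T. c B * of_bool (Poly_Mapping.keys \<alpha> \<subseteq> B))"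
    if "Poly_Mapping.keys \<alpha> \<subseteq> {..<n}" for \<alpha>
  proof -
    have "Linf (mono_poly \<alpha>) = Linf (mono_poly (squarefree_expo (Poly_Mapping.keys \<alpha>)))"
      using rel that by (rule boolean_functional_reduces_to_squarefree)
    also have "\<dots> = (\<Sum>B\<in>T. c B * of_bool (Poly_Mapping.keys \<alpha> \<subseteq> B))"
      unfolding c[OF that] by (rule sum.mono_neutral_right) (auto simp: T_def)
    finally show ?thesis .
  qed
  let ?k = "max D n"
  obtain J where J: "col_basis (expos_le n ?k) (\<lambda>\<alpha> \<beta>. Linf (mono_poly (\<alpha> + \<beta>))) (expos_le n ?k) J"
    and rank: "hankel_rank n ?k Linf = card J"
    using hankel_rank_eq_card_col_basis by blast
  have "card J = card T"
  proof (rule card_col_basis_weighted_gram[OF finite_expos_le T(2) _ _ _ J])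
    show "indep_cols (expos_le n ?k) (\<lambda>\<alpha> B. of_bool (Poly_Mapping.keys \<alpha> \<subseteq> B)) T"
      using T(1) by (rule indep_superset_indicators) simp
    show "c B \<noteq> 0" if "B \<in> T" for B using that by (simp add: T_def)
    fix \<alpha> \<beta> assume "\<alpha> \<in> expos_le n ?k" "\<beta> \<in> expos_le n ?k"
    then have "Poly_Mapping.keys (\<alpha> + \<beta>) \<subseteq> {..<n}" by (auto simp: expos_le_def keys_expo_add)
    from Linf[OF this] show "Linf (mono_poly (\<alpha> + \<beta>)) =
        (\<Sum>B\<in>T. c B * of_bool (Poly_Mapping.keys \<alpha> \<subseteq> B) * of_bool (Poly_Mapping.keys \<beta> \<subseteq> B))"
      by (simp add: keys_expo_add of_bool_conj mult.assoc)
  qed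
  then have "card T = hankel_rank n D Linf"
    using rank hankel_rank_flat_extension[OF flat, of ?k] by simp
  also have "\<dots> \<le> card (expos_le n D)" by (rule hankel_rank_le_card)
  finally show ?thesis using T(1) Linf by blast
qed

section \<open>A functional that needs many atoms\<close>

text \<open>
  On the moment curve \<open>t \<mapsto> (1, t, t\<^sup>2, \<dots>)\<close> each linear form is a nonzero polynomial in \<open>t\<close>, so all
  but finitely many \<open>t > 0\<close> will do.
\<close>

lemma exists_positive_vector_avoiding_hyperplanes:
  fixes a :: "'t \<Rightarrow> 'a \<Rightarrow> real"
  assumes "finite I" "finite TT" and "\<And>T. T \<in> TT \<Longrightarrow> \<exists>i\<in>I. a T i \<noteq> 0"
  shows "\<exists>u. (\<forall>i\<in>I. u i > 0) \<and> (\<forall>T\<in>TT. (\<Sum>i\<in>I. a T i * u i) \<noteq> 0)"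
proof -
  obtain h where h: "bij_betw h I {0..<card I}" using ex_bij_betw_finite_nat[OF assms(1)] by blast
  define g where "g = the_inv_into I h"
  have g: "bij_betw g {0..<card I} I" unfolding g_def by (rule bij_betw_the_inv_into[OF h])
  have hg: "h (g k) = k" if "k < card I" for k
    using h that unfolding g_def by (auto simp: bij_betw_def f_the_inv_into_f)
  have sum: "(\<Sum>i\<in>I. a T i * t ^ h i) = (\<Sum>k\<le>card I. (if k < card I then a T (g k) else 0) * t ^ k)" for T t
  proof -
    have "(\<Sum>i\<in>I. a T i * t ^ h i) = (\<Sum>k\<in>{0..<card I}. a T (g k) * t ^ k)"
      using hg by (subst sum.reindex_bij_betw[OF g, symmetric]) auto
    also have "\<dots> = (\<Sum>k\<le>card I. (if k < card I then a T (g k) else 0) * t ^ k)"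
      by (intro sum.mono_neutral_cong_left) auto
    finally show ?thesis .
  qed
  have "finite {t. (\<Sum>i\<in>I. a T i * t ^ h i) = 0}" if T: "T \<in> TT" for T
  proof -
    obtain i where i: "i \<in> I" "a T i \<noteq> 0" using assms(3)[OF T] by blast
    have "h i < card I" "g (h i) = i" using h i(1) unfolding g_def by (auto simp: bij_betw_def the_inv_into_f_f)
    with i show ?thesis unfolding sum polyfun_finite_roots by (intro exI[of _ "h i"]) auto
  qed
  then have "finite (\<Union>T\<in>TT. {t. (\<Sum>i\<in>I. a T i * t ^ h i) = 0})" using assms(2) by blast
  moreover have "infinite {0 :: real<..}" by (rule infinite_Ioi)
  ultimately obtain t where "t > 0" "t \<notin> (\<Union>T\<in>TT. {t. (\<Sum>i\<in>I. a T i * t ^ h i) = 0})"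
    by (meson finite_subset greaterThan_iff subsetI)
  then show ?thesis by (intro exI[of _ "\<lambda>i. t ^ h i"]) auto
qed

text \<open>
  Every monomial of degree \<open>\<le> k + 1\<close> is a monomial of degree \<open>\<le> k\<close> times \<open>1\<close> or one of the \<open>n\<close> variables.
\<close>

lemma card_expos_le: "card (expos_le n k) \<le> (n + 1) ^ k"
proof (induction k)
  case 0
  have "expos_le n 0 \<subseteq> {0}"
    by (auto simp: expos_le_def expo_deg_def in_keys_iff intro!: poly_mapping_eqI)
  then show ?case using card_mono[of "{0 :: expo}"] by fastforce
next
  case (Suc k)
  \<comment> \<open>The index \<open>n\<close> stands for the factor \<open>1\<close>.\<close>
  let ?f = "\<lambda>(i, \<alpha>). if i < n then Poly_Mapping.single i 1 + \<alpha> else \<alpha> :: expo"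
  have "expos_le n (Suc k) \<subseteq> ?f ` ({..n} \<times> expos_le n k)"
  proof
    fix \<alpha> assume \<alpha>: "\<alpha> \<in> expos_le n (Suc k)"
    show "\<alpha> \<in> ?f ` ({..n} \<times> expos_le n k)"
    proof (cases "\<alpha> = 0")
      case True
      then show ?thesis by (intro image_eqI[of _ _ "(n, 0)"]) (auto simp: expos_le_def expo_deg_def)
    next
      case False
      then obtain i where i: "i \<in> Poly_Mapping.keys \<alpha>" by (metis all_not_in_conv keys_eq_empty)
      define \<beta> where "\<beta> = \<alpha> - Poly_Mapping.single i 1"
      have eq: "\<alpha> = Poly_Mapping.single i 1 + \<beta>"
        using i by (intro poly_mapping_eqI) (auto simp: \<beta>_def lookup_add lookup_minus lookup_single when_def in_keys_iff)
      have "\<beta> \<in> expos_le n k" "i < n"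
        using \<alpha> by (auto simp: eq expos_le_def keys_expo_add expo_deg_add expo_deg_def[of "Poly_Mapping.single _ _"])
      then show ?thesis using eq by (intro image_eqI[of _ _ "(i, \<beta>)"]) auto
    qed
  qed
  then have "card (expos_le n (Suc k)) \<le> card ({..n} \<times> expos_le n k)"
    using finite_expos_le by (meson card_image_le card_mono finite_SigmaI finite_atMost finite_imageI le_trans)
  also have "\<dots> \<le> (n + 1) ^ Suc k" using mult_le_mono2[OF Suc.IH, of "n + 1"] by (simp add: card_cartesian_product)
  finally show ?case .
qed

text \<open>
  This compares the orders of growth \<open>m - 1\<close> and \<open>m\<close> in \<open>n\<close>; the bound on \<open>n\<close> comes from
  \<open>n choose m \<ge> (n / m)\<^sup>m\<close> and \<open>n + 1 \<le> 2 n\<close>.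
\<close>

lemma power_less_binomial:
  assumes "m > 0" "(2 * m) ^ m \<le> n"
  shows "(n + 1) ^ (m - 1) < n choose m"
proof -
  have "m \<le> (2 * m) ^ m" using assms(1) self_le_power[of "2 * m" m] by simp
  then have mn: "m \<le> n" "n \<ge> 1" using assms by auto
  have "real ((n + 1) ^ (m - 1)) * real m ^ m \<le> real ((2 * n) ^ (m - 1)) * real m ^ m"
    using mn by (intro mult_right_mono of_nat_mono power_mono) auto
  also have "\<dots> = real n ^ (m - 1) * (2 ^ (m - 1) * real m ^ m)" by (simp add: power_mult_distrib)
  also have "\<dots> < real n ^ (m - 1) * (2 ^ m * real m ^ m)"
    using mn assms(1) by (intro mult_strict_left_mono mult_strict_right_mono power_strict_increasing) auto
  also have "2 ^ m * real m ^ m = real ((2 * m) ^ m)" by (simp add: power_mult_distrib)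
  also have "real n ^ (m - 1) * real ((2 * m) ^ m) \<le> real n ^ (m - 1) * real n"
    using assms(2) by (intro mult_left_mono of_nat_mono) auto
  also have "\<dots> = real n ^ m" using assms(1) by (metis One_nat_def Suc_pred power_Suc2)
  finally have "real ((n + 1) ^ (m - 1)) < real n ^ m / real m ^ m"
    using assms(1) by (simp add: pos_less_divide_eq)
  also have "\<dots> = (real n / real m) ^ m" by (simp add: power_divide)
  also have "\<dots> \<le> real (n choose m)" by (rule binomial_ge_n_over_k_pow_k[OF mn(1)])
  finally show ?thesis by linarith
qed

definition vertex :: "nat \<Rightarrow> nat set \<Rightarrow> nat \<Rightarrow> real" where
  "vertex n A = (\<lambda>i\<in>{..<n}. of_bool (i \<in> A))"

lemma vertex_in_space: "vertex n A \<in> space (Pi\<^sub>M {..<n} (\<lambda>_. borel))"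
  by (simp add: vertex_def space_PiM)

lemma inj_on_vertex: "inj_on (vertex n) (Pow {..<n})"
proof (rule inj_onI)
  fix A B assume AB: "A \<in> Pow {..<n}" "B \<in> Pow {..<n}" and eq: "vertex n A = vertex n B"
  have "i \<in> A \<longleftrightarrow> i \<in> B" if "i < n" for i
    using fun_cong[OF eq, of i] that by (simp add: vertex_def of_bool_eq_iff)
  with AB show "A = B" by auto
qed

lemma eval_mono_poly_vertex:
  assumes "Poly_Mapping.keys \<alpha> \<subseteq> {..<n}"
  shows "eval_poly (vertex n A) (mono_poly \<alpha>) = of_bool (Poly_Mapping.keys \<alpha> \<subseteq> A)"
proof (cases "Poly_Mapping.keys \<alpha> \<subseteq> A")
  case True
  then show ?thesis unfolding eval_mono_poly using assms
    by (auto simp: vertex_def subset_iff intro!: prod.neutral)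
next
  case False
  then obtain i where i: "i \<in> Poly_Mapping.keys \<alpha>" "i \<notin> A" by blast
  then have "vertex n A i ^ Poly_Mapping.lookup \<alpha> i = 0"
    using assms by (auto simp: vertex_def subset_iff in_keys_iff)
  with i False show ?thesis unfolding eval_mono_poly by auto
qed

text \<open>
  The functional has one atom \<open>1\<^sub>A\<close> for every \<open>A\<close> of size \<open>2d\<close>. Since \<open>1\<^sub>A\<close> is the only one of these at
  which the squarefree monomial of \<open>A\<close> does not vanish, the weights \<open>u A\<close> are the values of \<open>L\<close> at these
  monomials. A flat extension from \<open>D < 2d\<close> would express them by a set \<open>T\<close> of fewer than
  \<open>n choose 2d\<close> vertices, and the linear form \<open>a T\<close> that annihilates all such expressions would vanish
  at \<open>u\<close>.
\<close>

lemma exists_moment_functional_requiring_late_flatness: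
  assumes d: "d \<ge> 2" and n: "card (expos_le n (2 * d - 1)) < n choose (2 * d)"
  shows "\<exists>L. moment_functional n (2 * d) L \<and>
    \<not> (\<exists>D L\<^sub>0 Linf. d \<le> D \<and> D < 2 * d \<and> extends_on (polys_le n (2 * d)) L\<^sub>0 L \<and>
         moment_functional n (2 * D) L\<^sub>0 \<and> flat_extension n D Linf L\<^sub>0)"
proof -
  define \<A> where "\<A> = {A. A \<subseteq> {..<n} \<and> card A = 2 * d}"
  define \<T> where "\<T> = {T. T \<subseteq> Pow {..<n} \<and> card T < n choose (2 * d)}"
  have fin: "finite \<A>" "finite \<T>" by (auto simp: \<A>_def \<T>_def intro: finite_subset[of _ "Pow (Pow {..<n})"])
  have finA: "finite A" if "A \<in> \<A>" for A using that finite_subset by (auto simp: \<A>_def)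
  have card\<A>: "card \<A> = n choose (2 * d)" using n_subsets[of "{..<n}" "2 * d"] by (simp add: \<A>_def)
  have "\<exists>a. (\<forall>B\<in>T. (\<Sum>A\<in>\<A>. a A * of_bool (A \<subseteq> B)) = 0) \<and> (\<exists>A\<in>\<A>. a A \<noteq> (0 :: real))" if T: "T \<in> \<T>" for T
  proof -
    have "finite T" "card T < card \<A>" using T finite_subset[of T "Pow {..<n}"] by (auto simp: \<T>_def card\<A>)
    then have "\<not> indep_cols T (\<lambda>B A. of_bool (A \<subseteq> B)) \<A>" using fin(1) by (intro underdetermined_not_indep)
    then show ?thesis unfolding indep_cols_def by blast
  qed
  then obtain a where a: "\<And>T B. T \<in> \<T> \<Longrightarrow> B \<in> T \<Longrightarrow> (\<Sum>A\<in>\<A>. a T A * of_bool (A \<subseteq> B)) = (0 :: real)"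
    and a_nz: "\<And>T. T \<in> \<T> \<Longrightarrow> \<exists>A\<in>\<A>. a T A \<noteq> 0" by metis
  obtain u where u: "\<And>A. A \<in> \<A> \<Longrightarrow> u A > (0 :: real)" and u_nz: "\<And>T. T \<in> \<T> \<Longrightarrow> (\<Sum>A\<in>\<A>. a T A * u A) \<noteq> 0"
    using exists_positive_vector_avoiding_hyperplanes[of \<A> \<T> a, OF fin a_nz] by blast
  have inj: "inj_on (vertex n) \<A>" using inj_on_vertex by (rule inj_on_subset) (auto simp: \<A>_def)
  \<comment> \<open>The weights of an atomic functional are indexed by points, those of \<open>u\<close> by subsets.\<close>
  define w where "w = (\<lambda>x. u (the_inv_into \<A> (vertex n) x))"
  define L where "L = atomic_functional (vertex n ` \<A>) w"
  have L_mono: "L (mono_poly \<alpha>) = (\<Sum>A\<in>\<A>. u A * of_bool (Poly_Mapping.keys \<alpha> \<subseteq> A))"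
    if "Poly_Mapping.keys \<alpha> \<subseteq> {..<n}" for \<alpha>
    unfolding L_def atomic_functional_def sum.reindex[OF inj]
    using that by (intro sum.cong) (simp_all add: w_def the_inv_into_f_f[OF inj] eval_mono_poly_vertex)
  have moment: "moment_functional n (2 * d) L"
    unfolding L_def
  proof (rule moment_functional_atomic)
    show "vertex n ` \<A> \<subseteq> space (Pi\<^sub>M {..<n} (\<lambda>_. borel))" using vertex_in_space by blast
    show "w x \<ge> 0" if "x \<in> vertex n ` \<A>" for x
      using that u by (auto simp: w_def the_inv_into_f_f[OF inj] intro: less_imp_le)
  qed (simp add: fin)
  have False if D: "d \<le> D" "D < 2 * d" and ext: "extends_on (polys_le n (2 * d)) L\<^sub>0 L"
    and L0: "moment_functional n (2 * D) L\<^sub>0" and flat: "flat_extension n D Linf L\<^sub>0" for D L\<^sub>0 Linf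
  proof -
    have L0L: "L\<^sub>0 (mono_poly \<alpha>) = L (mono_poly \<alpha>)" if "\<alpha> \<in> expos_le n (2 * d)" for \<alpha>
      using ext that by (simp add: extends_on_def)
    have L_single: "L\<^sub>0 (mono_poly (Poly_Mapping.single i k)) = (\<Sum>A\<in>\<A>. u A * of_bool (i \<in> A))"
      if "i < n" "k \<noteq> 0" "k \<le> 4" for i k
      using that d by (subst L0L) (auto simp: L_mono intro!: single_in_expos_le)
    have "D \<ge> 2" using D d by simp
    from boolean_flat_extension_sparse[OF flat L0 this] obtain T c where T: "T \<subseteq> Pow {..<n}"
      "card T \<le> card (expos_le n D)" and Linf: "\<And>\<alpha>. Poly_Mapping.keys \<alpha> \<subseteq> {..<n} \<Longrightarrow>
        Linf (mono_poly \<alpha>) = (\<Sum>B\<in>T. c B * of_bool (Poly_Mapping.keys \<alpha> \<subseteq> B))"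
      by (auto simp: L_single)
    have "card (expos_le n D) \<le> card (expos_le n (2 * d - 1))"
      using D by (intro card_mono finite_expos_le expos_le_mono) simp
    with T n have T': "T \<in> \<T>" by (simp add: \<T>_def)
    have u_eq: "u A = (\<Sum>B\<in>T. c B * of_bool (A \<subseteq> B))" if A: "A \<in> \<A>" for A
    proof -
      have deg: "squarefree_expo A \<in> expos_le n (2 * d)" and keys: "Poly_Mapping.keys (squarefree_expo A) \<subseteq> {..<n}"
        using A finA[OF A] by (auto simp: \<A>_def expos_le_def expo_deg_squarefree_expo)
      have "L (mono_poly (squarefree_expo A)) = (\<Sum>A'\<in>\<A>. if A' = A then u A else 0)"
        unfolding L_mono[OF keys]
      proof (rule sum.cong[OF refl])
        fix A' assume A': "A' \<in> \<A>"
        have "A \<subseteq> A' \<longleftrightarrow> A' = A"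
          using A A' card_subset_eq[OF finA[OF A'], of A] by (auto simp: \<A>_def)
        then show "u A' * of_bool (Poly_Mapping.keys (squarefree_expo A) \<subseteq> A') = (if A' = A then u A else 0)"
          using finA[OF A] by simp
      qed
      also have "\<dots> = u A" using A fin by simp
      finally have "u A = L\<^sub>0 (mono_poly (squarefree_expo A))" using L0L[OF deg] by simp
      also have "\<dots> = Linf (mono_poly (squarefree_expo A))"
      proof -
        have "mono_poly (squarefree_expo A) \<in> polys_le n (2 * D)"
          using expos_le_mono[of "2 * d" "2 * D" n] D(1) deg by auto
        then show ?thesis using flat by (simp add: flat_extension_def extends_on_def)
      qed
      also have "\<dots> = (\<Sum>B\<in>T. c B * of_bool (A \<subseteq> B))" using Linf[OF keys] finA[OF A] by simp
      finally show ?thesis .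
    qed
    have "(\<Sum>A\<in>\<A>. a T A * u A) = (\<Sum>A\<in>\<A>. \<Sum>B\<in>T. c B * (a T A * of_bool (A \<subseteq> B)))"
      by (intro sum.cong) (simp_all only: u_eq sum_distrib_left mult.left_commute)
    also have "\<dots> = (\<Sum>B\<in>T. c B * (\<Sum>A\<in>\<A>. a T A * of_bool (A \<subseteq> B)))"
      by (subst sum.swap) (simp add: sum_distrib_left)
    also have "\<dots> = 0" using a[OF T'] by (intro sum.neutral) auto
    finally show False using u_nz[OF T'] by simp
  qed
  with moment show ?thesis by blast
qed

theorem theorem6p2:
  shows "(\<forall>(n::nat) (d::nat) (L :: rpoly \<Rightarrow> real).
            n > 0 \<longrightarrow> d > 0 \<longrightarrow> moment_functional n (2 * d) L \<longrightarrow>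
            (\<exists>D L\<^sub>0 Linf. d \<le> D \<and> D \<le> 2 * d \<and>
               extends_on (polys_le n (2 * d)) L\<^sub>0 L \<and>
               moment_functional n (2 * D) L\<^sub>0 \<and>
               flat_extension n D Linf L\<^sub>0)) \<and>
         (\<forall>d::nat. d \<noteq> 1 \<longrightarrow>
            (\<exists>N::nat. \<forall>n\<ge>N. \<exists>L :: rpoly \<Rightarrow> real.
               moment_functional n (2 * d) L \<and>
               \<not> (\<exists>D L\<^sub>0 Linf. d \<le> D \<and> D < 2 * d \<and>
                    extends_on (polys_le n (2 * d)) L\<^sub>0 L \<and>
                    moment_functional n (2 * D) L\<^sub>0 \<and>
                    flat_extension n D Linf L\<^sub>0)))"
proof (intro conjI allI impI)
  fix n d :: nat and L :: "rpoly \<Rightarrow> real"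
  assume "moment_functional n (2 * d) L"
  then obtain L\<^sub>0 where "extends_on (polys_le n (2 * d)) L\<^sub>0 L" "moment_functional n (2 * (2 * d)) L\<^sub>0"
    "flat_extension n (2 * d) L\<^sub>0 L\<^sub>0"
    using moment_functional_has_flat_extension by blast
  then show "\<exists>D L\<^sub>0 Linf. d \<le> D \<and> D \<le> 2 * d \<and> extends_on (polys_le n (2 * d)) L\<^sub>0 L \<and>
      moment_functional n (2 * D) L\<^sub>0 \<and> flat_extension n D Linf L\<^sub>0"
    by (intro exI[of _ "2 * d"] exI[of _ L\<^sub>0]) simp
next
  fix d :: nat
  assume "d \<noteq> 1"
  let ?P = "\<lambda>n L. moment_functional n (2 * d) L \<and>
    \<not> (\<exists>D L\<^sub>0 Linf. d \<le> D \<and> D < 2 * d \<and> extends_on (polys_le n (2 * d)) L\<^sub>0 L \<and>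
         moment_functional n (2 * D) L\<^sub>0 \<and> flat_extension n D Linf L\<^sub>0)"
  show "\<exists>N. \<forall>n\<ge>N. \<exists>L. ?P n L"
  proof (cases "d = 0")
    case True
    \<comment> \<open>For \<open>d = 0\<close> there is no \<open>D < 2d\<close>, so any moment functional will do.\<close>
    have "?P n (atomic_functional {} (\<lambda>_. 0))" for n
      using True by (auto intro: moment_functional_atomic)
    then show ?thesis by blast
  next
    case False
    with \<open>d \<noteq> 1\<close> have d: "d \<ge> 2" by simp
    have "\<exists>L. ?P n L" if "n \<ge> (2 * (2 * d)) ^ (2 * d)" for n
    proof (rule exists_moment_functional_requiring_late_flatness[OF d])
      have "card (expos_le n (2 * d - 1)) \<le> (n + 1) ^ (2 * d - 1)" by (rule card_expos_le)
      also have "\<dots> < n choose (2 * d)" using d that by (intro power_less_binomial) auto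
      finally show "card (expos_le n (2 * d - 1)) < n choose (2 * d)" .
    qed
    then show ?thesis by blast
  qed
qed

end
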